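(* Let $p\in(0,\infty)$ with $p\neq2$, let $\mathfrak N$ be a $\mathrm{II}_1$ factor, and let $\psi$ be a surjective $L^p$-isometry on $\mathscr U(\mathfrak N)$. If $\psi(U)=U$ for every self-adjoint unitary $U\in\mathfrak N$ and $\psi(e^{i\theta}I)=e^{i\theta}I$ for every $\theta\in\mathbb R$, then $\psi(e^{i\theta}U)=e^{i\theta}U$ for every self-adjoint unitary $U\in\mathfrak N$ and every $\theta\in\mathbb R$.
   Context: $\mathscr U(\mathfrak N)$ is the unitary group of $\mathfrak N$; with $\tau$ the tracial state of $\mathfrak N$, $\|A\|_p:=\tau(|A|^p)^{1/p}$. A map $\psi:\mathscr U(\mathfrak N)\to\mathscr U(\mathfrak N)$ is an $L^p$-isometry if $\|U-V\|_p=\|\psi(U)-\psi(V)\|_p$ for all $U,V\in\mathscr U(\mathfrak N)$. *)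

theory Defs
  imports "HOL-Analysis.Analysis" "HOL-Computational_Algebra.Polynomial"
begin

section \<open>Complex Hilbert spaces and their bounded operators\<close>

class complex_hilbert = banach +
  fixes scaleC :: "complex \<Rightarrow> 'a \<Rightarrow> 'a" (infixr "*\<^sub>C" 75)
    and cinner :: "'a \<Rightarrow> 'a \<Rightarrow> complex"
  assumes scaleC_add_right: "c *\<^sub>C (x + y) = c *\<^sub>C x + c *\<^sub>C y"
    and scaleC_add_left: "(c + d) *\<^sub>C x = c *\<^sub>C x + d *\<^sub>C x"
    and scaleC_scaleC: "c *\<^sub>C d *\<^sub>C x = (c * d) *\<^sub>C x"
    and scaleR_scaleC: "r *\<^sub>R x = complex_of_real r *\<^sub>C x"
    and cinner_commute: "cinner x y = cnj (cinner y x)"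
    and cinner_add_left: "cinner (x + y) z = cinner x z + cinner y z"
    and cinner_scaleC_left: "cinner (c *\<^sub>C x) y = c * cinner x y"
    and cinner_self: "cinner x x = complex_of_real ((norm x)\<^sup>2)"

lemma norm_scaleC: "norm (c *\<^sub>C x) = cmod c * norm (x :: 'h::complex_hilbert)"
proof -
  have "cinner (c *\<^sub>C x) (c *\<^sub>C x) = (c * cnj c) * cinner x x"
    by (metis cinner_commute cinner_scaleC_left complex_cnj_mult mult.assoc mult.commute)
  then have "complex_of_real ((norm (c *\<^sub>C x))\<^sup>2) = complex_of_real ((cmod c * norm x)\<^sup>2)"
    by (simp only: cinner_self complex_norm_square[symmetric] power_mult_distrib of_real_mult)
  then have "(norm (c *\<^sub>C x))\<^sup>2 = (cmod c * norm x)\<^sup>2"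
    by (simp only: of_real_eq_iff)
  then show ?thesis
    by (simp add: power2_eq_iff_nonneg)
qed

lemma bounded_linear_scaleC: "bounded_linear (\<lambda>x :: 'h::complex_hilbert. c *\<^sub>C x)"
proof (rule bounded_linear_intro)
  show "c *\<^sub>C (x + y) = c *\<^sub>C x + c *\<^sub>C y" for x y :: 'h
    by (rule scaleC_add_right)
  show "c *\<^sub>C (r *\<^sub>R x) = r *\<^sub>R (c *\<^sub>C x)" for r and x :: 'h
    by (simp add: scaleR_scaleC scaleC_scaleC mult.commute)
  show "norm (c *\<^sub>C x) \<le> norm x * cmod c" for x :: 'h
    by (simp add: norm_scaleC)
qed

text \<open>
  The type of bounded real-linear maps supplies the operator norm and composition;
  \<open>bounded_ops\<close> singles out the complex-linear ones, that is, \<open>B(H)\<close>.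
\<close>

type_synonym 'h oper = "'h \<Rightarrow>\<^sub>L 'h"

definition bounded_ops :: "'h::complex_hilbert oper set" where
  "bounded_ops = {A. \<forall>c x. blinfun_apply A (c *\<^sub>C x) = c *\<^sub>C blinfun_apply A x}"

lift_definition op_scale :: "complex \<Rightarrow> 'h::complex_hilbert oper \<Rightarrow> 'h oper"
  is "\<lambda>c A x. c *\<^sub>C A x"
  by (rule bounded_linear_compose[OF bounded_linear_scaleC])

definition adjoint_op :: "'h::complex_hilbert oper \<Rightarrow> 'h oper" where
  "adjoint_op A = (THE B. B \<in> bounded_ops \<and>
     (\<forall>x y. cinner (blinfun_apply A x) y = cinner x (blinfun_apply B y)))"

definition positive_op :: "'h::complex_hilbert oper \<Rightarrow> bool" where
  "positive_op A \<longleftrightarrow> A \<in> bounded_ops \<and>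
     (\<forall>x. cinner (blinfun_apply A x) x \<in> \<real> \<and> 0 \<le> Re (cinner (blinfun_apply A x) x))"

definition op_le :: "'h::complex_hilbert oper \<Rightarrow> 'h oper \<Rightarrow> bool" where
  "op_le A B \<longleftrightarrow> positive_op (B - A)"

section \<open>Continuous functional calculus and absolute value\<close>

definition op_spectrum :: "'h::complex_hilbert oper \<Rightarrow> complex set" where
  "op_spectrum A = {c. \<not> (\<exists>B\<in>bounded_ops.
     B o\<^sub>L (A - op_scale c id_blinfun) = id_blinfun \<and>
     (A - op_scale c id_blinfun) o\<^sub>L B = id_blinfun)}"

primrec op_pow :: "'h::complex_hilbert oper \<Rightarrow> nat \<Rightarrow> 'h oper" where
  "op_pow A 0 = id_blinfun"
| "op_pow A (Suc n) = A o\<^sub>L op_pow A n"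

definition op_poly :: "real poly \<Rightarrow> 'h::complex_hilbert oper \<Rightarrow> 'h oper" where
  "op_poly q A = (\<Sum>i\<le>degree q. coeff q i *\<^sub>R op_pow A i)"

text \<open>
  \<open>cfc f A\<close> is meant for self-adjoint \<open>A\<close>, whose spectrum is real, and \<open>f\<close> continuous on
  it: \<open>f(A)\<close> is the norm limit of \<open>q\<^sub>n(A)\<close> for all real polynomials \<open>q\<^sub>n\<close> converging to \<open>f\<close>
  uniformly on the spectrum.
\<close>

definition cfc :: "(real \<Rightarrow> real) \<Rightarrow> 'h::complex_hilbert oper \<Rightarrow> 'h oper" where
  "cfc f A = (THE B. \<forall>q :: nat \<Rightarrow> real poly.
     uniform_limit {t. complex_of_real t \<in> op_spectrum A} (\<lambda>n. poly (q n)) f sequentially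
       \<longrightarrow> (\<lambda>n. op_poly (q n) A) \<longlonglongrightarrow> B)"

definition abs_op :: "'h::complex_hilbert oper \<Rightarrow> 'h oper" where
  "abs_op A = cfc sqrt (adjoint_op A o\<^sub>L A)"

section \<open>Factors of type \<open>II\<^sub>1\<close> and their trace\<close>

definition commutant :: "'h::complex_hilbert oper set \<Rightarrow> 'h oper set" where
  "commutant S = {B \<in> bounded_ops. \<forall>A\<in>S. A o\<^sub>L B = B o\<^sub>L A}"

definition von_neumann_algebra :: "'h::complex_hilbert oper set \<Rightarrow> bool" where
  "von_neumann_algebra N \<longleftrightarrow> N \<subseteq> bounded_ops \<and> (\<forall>A\<in>N. adjoint_op A \<in> N) \<and>
     commutant (commutant N) = N"

definition factor :: "'h::complex_hilbert oper set \<Rightarrow> bool" where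
  "factor N \<longleftrightarrow> von_neumann_algebra N \<and> (id_blinfun :: 'h oper) \<noteq> 0 \<and>
     N \<inter> commutant N = range (\<lambda>c. op_scale c id_blinfun)"

definition projections :: "'h::complex_hilbert oper set \<Rightarrow> 'h oper set" where
  "projections N = {P \<in> N. adjoint_op P = P \<and> P o\<^sub>L P = P}"

definition minimal_projection :: "'h::complex_hilbert oper set \<Rightarrow> 'h oper \<Rightarrow> bool" where
  "minimal_projection N P \<longleftrightarrow> P \<in> projections N \<and> P \<noteq> 0 \<and>
     (\<forall>Q\<in>projections N. op_le Q P \<longrightarrow> Q = 0 \<or> Q = P)"

definition mvn_equivalent ::
  "'h::complex_hilbert oper set \<Rightarrow> 'h oper \<Rightarrow> 'h oper \<Rightarrow> bool" where
  "mvn_equivalent N P Q \<longleftrightarrow>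
     (\<exists>V\<in>N. adjoint_op V o\<^sub>L V = P \<and> V o\<^sub>L adjoint_op V = Q)"

definition finite_projection :: "'h::complex_hilbert oper set \<Rightarrow> 'h oper \<Rightarrow> bool" where
  "finite_projection N P \<longleftrightarrow> P \<in> projections N \<and>
     (\<forall>Q\<in>projections N. op_le Q P \<and> mvn_equivalent N P Q \<longrightarrow> Q = P)"

definition II1_factor :: "'h::complex_hilbert oper set \<Rightarrow> bool" where
  "II1_factor N \<longleftrightarrow> factor N \<and> finite_projection N id_blinfun \<and>
     (\<nexists>P. minimal_projection N P)"

definition tracial_state ::
  "'h::complex_hilbert oper set \<Rightarrow> ('h oper \<Rightarrow> complex) \<Rightarrow> bool" where
  "tracial_state N \<tau> \<longleftrightarrow>
     (\<forall>A\<in>N. \<forall>B\<in>N. \<tau> (A + B) = \<tau> A + \<tau> B) \<and>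
     (\<forall>c. \<forall>A\<in>N. \<tau> (op_scale c A) = c * \<tau> A) \<and>
     (\<forall>A\<in>N. positive_op A \<longrightarrow> \<tau> A \<in> \<real> \<and> 0 \<le> Re (\<tau> A)) \<and>
     \<tau> id_blinfun = 1 \<and>
     (\<forall>A\<in>N. \<forall>B\<in>N. \<tau> (A o\<^sub>L B) = \<tau> (B o\<^sub>L A))"

definition faithful_state ::
  "'h::complex_hilbert oper set \<Rightarrow> ('h oper \<Rightarrow> complex) \<Rightarrow> bool" where
  "faithful_state N \<tau> \<longleftrightarrow> (\<forall>A\<in>N. positive_op A \<and> \<tau> A = 0 \<longrightarrow> A = 0)"

text \<open>
  Normality: \<open>\<tau>\<close> preserves the least upper bound \<open>S\<close> of every increasing net of self-adjoint
  operators, the net being replaced by its range, an upward directed set \<open>D\<close>.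
\<close>

definition normal_state ::
  "'h::complex_hilbert oper set \<Rightarrow> ('h oper \<Rightarrow> complex) \<Rightarrow> bool" where
  "normal_state N \<tau> \<longleftrightarrow>
     (\<forall>D S. D \<noteq> {} \<and> D \<subseteq> {A \<in> N. adjoint_op A = A} \<and>
        (\<forall>A\<in>D. \<forall>B\<in>D. \<exists>C\<in>D. op_le A C \<and> op_le B C) \<and>
        S \<in> N \<and> adjoint_op S = S \<and> (\<forall>A\<in>D. op_le A S) \<and>
        (\<forall>T\<in>N. adjoint_op T = T \<and> (\<forall>A\<in>D. op_le A T) \<longrightarrow> op_le S T)
        \<longrightarrow> Re (\<tau> S) = (SUP A\<in>D. Re (\<tau> A)))"

text \<open>
  A \<open>II\<^sub>1\<close> factor has exactly one tracial state, and it is faithful and normal; \<open>is_trace N \<tau>\<close>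
  says that \<open>\<tau>\<close> is that state.
\<close>

definition is_trace ::
  "'h::complex_hilbert oper set \<Rightarrow> ('h oper \<Rightarrow> complex) \<Rightarrow> bool" where
  "is_trace N \<tau> \<longleftrightarrow> tracial_state N \<tau> \<and> faithful_state N \<tau> \<and> normal_state N \<tau>"

section \<open>The unitary group and its \<open>L\<^sup>p\<close>-isometries\<close>

definition unitary_group :: "'h::complex_hilbert oper set \<Rightarrow> 'h oper set" where
  "unitary_group N = {U \<in> N. adjoint_op U o\<^sub>L U = id_blinfun \<and> U o\<^sub>L adjoint_op U = id_blinfun}"

definition Lp_norm :: "('h::complex_hilbert oper \<Rightarrow> complex) \<Rightarrow> real \<Rightarrow> 'h oper \<Rightarrow> real" where
  "Lp_norm \<tau> p A = Re (\<tau> (cfc (\<lambda>t. t powr p) (abs_op A))) powr (1 / p)"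

definition Lp_isometry ::
  "'h::complex_hilbert oper set \<Rightarrow> ('h oper \<Rightarrow> complex) \<Rightarrow> real \<Rightarrow> ('h oper \<Rightarrow> 'h oper) \<Rightarrow> bool" where
  "Lp_isometry N \<tau> p \<psi> \<longleftrightarrow> \<psi> \<in> unitary_group N \<rightarrow> unitary_group N \<and>
     (\<forall>U\<in>unitary_group N. \<forall>V\<in>unitary_group N.
        Lp_norm \<tau> p (U - V) = Lp_norm \<tau> p (\<psi> U - \<psi> V))"

end

theory Submission
  imports Defs "HOL-Computational_Algebra.Fundamental_Theorem_Algebra"
begin

text \<open>
  Let \<open>\<lambda> = e\<^sup>i\<^sup>\<theta>\<close> and \<open>V = \<psi>(\<lambda>U)\<close>. The distances from \<open>\<lambda>U\<close> to \<open>\<lambda>\<close> and \<open>-\<lambda>\<close> satisfy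
  \<open>\<parallel>\<lambda>U - \<lambda>\<parallel>\<^sub>p\<^sup>p + \<parallel>\<lambda>U + \<lambda>\<parallel>\<^sub>p\<^sup>p = 2\<^sup>p\<close>, so the same holds for \<open>V\<close>. Since \<open>p \<noteq> 2\<close>, comparing \<open>t\<^sup>p\<close> with
  \<open>2\<^sup>p\<^sup>-\<^sup>2 t\<^sup>2\<close> on \<open>[0, 2]\<close> shows that a unitary attains this value only if its spectrum lies in
  \<open>{\<lambda>, -\<lambda>}\<close>; hence \<open>V = \<lambda>S\<close> with \<open>S\<close> a self-adjoint unitary. If \<open>\<mu>U\<close> and \<open>-\<mu>U\<close> are known to be fixed,
  the distances from \<open>V\<close> to them are those of the scalars \<open>\<lambda>\<close> and \<open>\<plusminus>\<mu>\<close>, and the tangent-line form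
  of Jensen's inequality for \<open>b \<mapsto> b\<^bsup>p/2\<^esup>\<close>, applied to both, gives
  \<open>Re(cnj \<lambda> \<mu>) (Re \<tau>(SU) - 1) = 0\<close>. With \<open>\<mu> = 1\<close> this yields \<open>S = U\<close> unless \<open>\<lambda>\<close> is \<open>\<plusminus>i\<close>, and then
  \<open>\<mu> = e\<^bsup>i\<pi>/4\<^esup>\<close> settles the remaining case.
\<close>

section \<open>Complex Hilbert spaces\<close>

text \<open>The functional calculus gives \<open>t powr p\<close> only as a limit of polynomials, so
  every estimate compares it on \<open>[0, norm A]\<close> with an even polynomial. Evaluated at
  \<open>abs_op A\<close>, this is a polynomial in \<open>adjoint_op A o\<^sub>L A\<close>, and when
  \<open>A\<close> is a sum or difference of unitaries its trace can be computed algebraically. Such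
  a comparison requires that polynomials nonnegative on the spectrum give positive operators, and
  the spectral theory below is built for that purpose. For exponent 2 the parallelogram law makes
  the sum of the two distances equal to 4 for every unitary, so it would carry no information. Both
  signs of \<mu> are needed because a tangent line bounds a trace from one side only; the two
  distances bound the same trace from opposite sides. The cosine of the angle between \<lambda> and
  \<mu> must not be 0, since it multiplies the trace to be recovered, nor have modulus 1, since one
  tangent point would be 0. The angle \<open>pi / 4\<close> meets both conditions relative to 0 as
  well as to the imaginary units.\<close>

lemma cinner_add_right: "cinner x (y + z) = cinner x y + cinner x (z :: 'h::complex_hilbert)"
  by (metis cinner_add_left cinner_commute complex_cnj_add)

lemma cinner_scaleC_right: "cinner x (c *\<^sub>C y) = cnj c * cinner x (y :: 'h::complex_hilbert)"
  by (metis cinner_commute cinner_scaleC_left complex_cnj_mult)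

lemma scaleC_one: "1 *\<^sub>C x = (x :: 'h::complex_hilbert)"
  using scaleR_scaleC[of 1 x] by simp

lemma scaleC_minus_one: "(- 1) *\<^sub>C x = - (x :: 'h::complex_hilbert)"
  using scaleR_scaleC[of "-1" x] by simp

lemma scaleC_minus_right: "c *\<^sub>C (- x) = - (c *\<^sub>C (x :: 'h::complex_hilbert))"
  by (metis scaleC_minus_one scaleC_scaleC mult.commute)

lemma scaleC_minus_left: "(- c) *\<^sub>C x = - (c *\<^sub>C (x :: 'h::complex_hilbert))"
  by (metis scaleC_minus_one scaleC_scaleC mult_minus_left mult_1)

lemma scaleC_diff_right: "c *\<^sub>C (x - y) = c *\<^sub>C x - c *\<^sub>C (y :: 'h::complex_hilbert)"
  using scaleC_add_right[of c x "- y"] by (simp add: scaleC_minus_right)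

lemma scaleC_zero_left: "0 *\<^sub>C x = (0 :: 'h::complex_hilbert)"
  using scaleR_scaleC[of 0 x] by simp

lemma scaleC_zero_right: "c *\<^sub>C 0 = (0 :: 'h::complex_hilbert)"
  using scaleC_diff_right[of c "0::'h" 0] by simp

lemma cinner_minus_left: "cinner (- x) y = - cinner x (y :: 'h::complex_hilbert)"
  using cinner_scaleC_left[of "-1" x y] by (simp add: scaleC_minus_one)

lemma cinner_minus_right: "cinner x (- y) = - cinner x (y :: 'h::complex_hilbert)"
  using cinner_scaleC_right[of x "-1" y] by (simp add: scaleC_minus_one)

lemma cinner_diff_left: "cinner (x - y) z = cinner x z - cinner y (z :: 'h::complex_hilbert)"
  using cinner_add_left[of x "-y" z] by (simp add: cinner_minus_left)

lemma cinner_diff_right: "cinner z (x - y) = cinner z x - cinner z (y :: 'h::complex_hilbert)"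
  using cinner_add_right[of z x "-y"] by (simp add: cinner_minus_right)

lemma cinner_scaleR_left: "cinner (r *\<^sub>R x) y = of_real r * cinner x (y :: 'h::complex_hilbert)"
  by (simp add: scaleR_scaleC cinner_scaleC_left)

lemma cinner_scaleR_right: "cinner x (r *\<^sub>R y) = of_real r * cinner x (y :: 'h::complex_hilbert)"
  by (simp add: scaleR_scaleC cinner_scaleC_right)

lemma Re_cinner_commute: "Re (cinner x y) = Re (cinner y (x :: 'h::complex_hilbert))"
  by (metis cinner_commute complex_cnj cinner_commute cnj.simps(1))

lemma norm_add_power2:
  "(norm (x + y))\<^sup>2 = (norm x)\<^sup>2 + 2 * Re (cinner x y) + (norm (y :: 'h::complex_hilbert))\<^sup>2"
proof -
  have "Re (cinner (x + y) (x + y)) = Re (cinner x x) + 2 * Re (cinner x y) + Re (cinner y y)"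
    using Re_cinner_commute[of y x] by (simp add: cinner_add_left cinner_add_right)
  then show ?thesis by (simp add: cinner_self)
qed

lemma norm_diff_power2:
  "(norm (x - y))\<^sup>2 = (norm x)\<^sup>2 - 2 * Re (cinner x y) + (norm (y :: 'h::complex_hilbert))\<^sup>2"
  using norm_add_power2[of x "- y"] by (simp add: cinner_minus_right)

lemma cinner_Cauchy_Schwarz: "cmod (cinner x y) \<le> norm x * norm (y :: 'h::complex_hilbert)"
proof (cases "y = 0")
  case True
  then show ?thesis using cinner_scaleR_right[of x 0 y] by simp
next
  case False
  define n where "n = (norm y)\<^sup>2"
  have n: "n > 0" using False by (simp add: n_def)
  define c where "c = cinner x y / of_real n"
  have "Re (cinner x (c *\<^sub>C y)) = (cmod (cinner x y))\<^sup>2 / n"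
  proof -
    have "cinner x (c *\<^sub>C y) = cinner x y * cnj (cinner x y) / of_real n"
      by (simp add: c_def cinner_scaleC_right)
    also have "\<dots> = of_real ((cmod (cinner x y))\<^sup>2 / n)"
      by (metis complex_norm_square of_real_divide)
    finally show ?thesis by (metis Re_complex_of_real)
  qed
  moreover have "(norm (c *\<^sub>C y))\<^sup>2 = (cmod (cinner x y))\<^sup>2 / n"
  proof -
    have "(norm (c *\<^sub>C y))\<^sup>2 = (cmod (cinner x y) / n)\<^sup>2 * n"
      using n by (simp add: norm_scaleC c_def norm_divide norm_power power_mult_distrib power_divide
          n_def)
    then show ?thesis using n by (simp add: power2_eq_square field_simps)
  qed
  ultimately have "0 \<le> (norm x)\<^sup>2 - (cmod (cinner x y))\<^sup>2 / n"
    using norm_diff_power2[of x "c *\<^sub>C y"] zero_le_power2[of "norm (x - c *\<^sub>C y)"] by linarith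
  then have "(cmod (cinner x y))\<^sup>2 \<le> (norm x * norm y)\<^sup>2"
    using n by (simp add: field_simps n_def)
  then show ?thesis by (rule power2_le_imp_le) simp
qed

lemma bounded_bilinear_cinner: "bounded_bilinear (cinner :: 'h::complex_hilbert \<Rightarrow> 'h \<Rightarrow> complex)"
proof
  show "\<exists>K. \<forall>a b :: 'h. cmod (cinner a b) \<le> norm a * norm b * K"
    by (rule exI[of _ 1]) (simp add: cinner_Cauchy_Schwarz)
qed (simp_all add: cinner_add_left cinner_add_right cinner_scaleR_left cinner_scaleR_right
      scaleR_conv_of_real)

lemma cinner_ext:
  assumes "\<And>z. cinner z x = cinner z (y :: 'h::complex_hilbert)"
  shows "x = y"
proof -
  have "cinner (x - y) (x - y) = 0"
    using assms by (simp add: cinner_diff_right)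
  then show ?thesis by (simp add: cinner_self)
qed

text \<open>The quadratic has a minimum at \<open>t = 0\<close>, so its derivative
  \<open>2 * b\<close> there vanishes. The test point \<open>- b / (a + 1)\<close> serves also for
  \<open>a = 0\<close>. This is the first-variation argument at a minimiser.\<close>

lemma quadratic_nonneg_imp_linear_zero:
  fixes a b :: real
  assumes "\<And>t. 0 \<le> t\<^sup>2 * a + 2 * t * b" and "0 \<le> a"
  shows "b = 0"
proof (rule ccontr)
  assume b: "b \<noteq> 0"
  define d where "d = a + 1"
  have d: "d > 0" using assms(2) by (simp add: d_def)
  have "(- b / d)\<^sup>2 * (d - 1) + 2 * (- b / d) * b = - (b\<^sup>2 * (d + 1)) / d\<^sup>2"
    using d by (simp add: field_simps power2_eq_square)
  then have "(- b / (a + 1))\<^sup>2 * a + 2 * (- b / (a + 1)) * b = - (b\<^sup>2 * (a + 2)) / (a + 1)\<^sup>2"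
    by (simp add: d_def add.commute)
  also have "\<dots> < 0"
    using b assms(2) by (intro divide_neg_pos) auto
  finally show False using assms(1)[of "- b / (a + 1)"] by linarith
qed

text \<open>The representing vector minimises \<open>\<parallel>x\<parallel>\<^sup>2 - 2 Re (f x)\<close>; by the parallelogram law every
  minimising sequence is Cauchy.\<close>

theorem riesz_representation:
  fixes f :: "'h::complex_hilbert \<Rightarrow> complex"
  assumes add: "\<And>x y. f (x + y) = f x + f y" and scale: "\<And>c x. f (c *\<^sub>C x) = c * f x"
    and bound: "\<And>x. cmod (f x) \<le> norm x * K"
  shows "\<exists>y. \<forall>x. f x = cinner x y"
proof -
  have scaleR: "f (r *\<^sub>R x) = r *\<^sub>R f x" for r x
    by (simp add: scaleR_scaleC scale scaleR_conv_of_real)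
  have blf: "bounded_linear f"
    by (rule bounded_linear_intro[OF add scaleR bound])
  define F where "F x = (norm x)\<^sup>2 - 2 * Re (f x)" for x
  have F_lower: "- (K\<^sup>2) \<le> F x" for x
  proof -
    have "Re (f x) \<le> norm x * K"
      using bound[of x] complex_Re_le_cmod[of "f x"] by linarith
    then show ?thesis
      using zero_le_power2[of "norm x - K"] by (simp add: F_def power2_diff)
  qed
  have bdd: "bdd_below (range F)"
    by (rule bdd_belowI[of _ "- (K\<^sup>2)"]) (use F_lower in auto)
  define I where "I = Inf (range F)"
  have I_le: "I \<le> F x" for x
    unfolding I_def using bdd by (auto intro: cInf_lower)
  have "\<exists>x. F x < I + 1 / real (Suc n)" for n
    using cInf_lessD[of "range F" "I + 1 / real (Suc n)"] by (auto simp: I_def)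
  then obtain X where X: "\<And>n. F (X n) < I + 1 / real (Suc n)" by metis
  have par: "(norm (x - y))\<^sup>2 \<le> 2 * F x + 2 * F y - 4 * I" for x y
  proof -
    have "F ((1/2) *\<^sub>R (x + y)) = (norm (x + y))\<^sup>2 / 4 - Re (f x) - Re (f y)"
    proof -
      have "norm ((1/2) *\<^sub>R (x + y)) = norm (x + y) / 2" by simp
      then show ?thesis unfolding F_def by (simp only: scaleR add power_divide) (simp add: field_simps)
    qed
    then have "(norm (x - y))\<^sup>2 = 2 * F x + 2 * F y - 4 * F ((1/2) *\<^sub>R (x + y))"
      using norm_add_power2[of x y] norm_diff_power2[of x y] F_def[of x] F_def[of y]
      by linarith
    then show ?thesis using I_le[of "(1/2) *\<^sub>R (x + y)"] by linarith
  qed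
  have "Cauchy X"
  proof (rule metric_CauchyI)
    fix e :: real assume e: "0 < e"
    obtain M where M: "4 / e\<^sup>2 < real M" using reals_Archimedean2 by blast
    have small: "F (X n) < I + e\<^sup>2 / 4" if "n \<ge> M" for n
    proof -
      have "inverse (e\<^sup>2 / 4) < real (Suc n)" using M that by (simp add: inverse_eq_divide)
      then have "inverse (real (Suc n)) < inverse (inverse (e\<^sup>2 / 4))"
        using e by (intro less_imp_inverse_less) auto
      then have "1 / real (Suc n) < e\<^sup>2 / 4" by (simp add: inverse_eq_divide)
      then show ?thesis using X[of n] by linarith
    qed
    show "\<exists>M. \<forall>m\<ge>M. \<forall>n\<ge>M. dist (X m) (X n) < e"
    proof (intro exI[of _ M] allI impI)
      fix m n assume "M \<le> m" "M \<le> n"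
      then have "(dist (X m) (X n))\<^sup>2 < e\<^sup>2"
        using par[of "X m" "X n"] small[of m] small[of n] unfolding dist_norm by linarith
      then show "dist (X m) (X n) < e"
        using e by (auto intro: power2_less_imp_less[of _ e])
    qed
  qed
  then obtain x0 where x0: "X \<longlonglongrightarrow> x0"
    using Cauchy_convergent convergent_def by blast
  have "(\<lambda>n. F (X n)) \<longlonglongrightarrow> F x0"
    unfolding F_def by (intro tendsto_intros x0 bounded_linear.tendsto[OF blf])
  moreover have "(\<lambda>n. I + 1 / real (Suc n)) \<longlonglongrightarrow> I + 0"
    by (rule tendsto_add[OF tendsto_const LIMSEQ_Suc[OF lim_1_over_n]])
  ultimately have "F x0 \<le> I"
    using X by (intro LIMSEQ_le[of "\<lambda>n. F (X n)" "F x0" "\<lambda>n. I + 1 / real (Suc n)" I])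
      (auto intro: less_imp_le)
  then have min: "F x0 \<le> F x" for x using I_le[of x] by linarith
  have Re_eq: "Re (f h) = Re (cinner h x0)" for h
  proof -
    have "Re (cinner h x0) - Re (f h) = 0"
    proof (rule quadratic_nonneg_imp_linear_zero[of "(norm h)\<^sup>2"])
      fix t :: real
      have "F (x0 + t *\<^sub>R h) = F x0 + t\<^sup>2 * (norm h)\<^sup>2 + 2 * t * (Re (cinner h x0) - Re (f h))"
        using Re_cinner_commute[of x0 h]
        by (simp add: F_def norm_add_power2 cinner_scaleR_right add scaleR power_mult_distrib
            algebra_simps)
      then show "0 \<le> t\<^sup>2 * (norm h)\<^sup>2 + 2 * t * (Re (cinner h x0) - Re (f h))"
        using min[of "x0 + t *\<^sub>R h"] by linarith
    qed simp
    then show ?thesis by simp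
  qed
  have "f h = cinner h x0" for h
  proof (rule complex_eqI)
    show "Re (f h) = Re (cinner h x0)" by (rule Re_eq)
    \<comment> \<open>The variation used real multiples only and controls real parts; evaluating at
      \<open>\<i> *\<^sub>C h\<close> turns imaginary parts into real ones.\<close>
    show "Im (f h) = Im (cinner h x0)"
      using Re_eq[of "\<i> *\<^sub>C h"] by (simp add: scale cinner_scaleC_left)
  qed
  then show ?thesis by blast
qed

section \<open>Bounded operators and adjoints\<close>

lemma op_scale_apply [simp]: "op_scale c A x = c *\<^sub>C A x"
  by (simp add: op_scale.rep_eq)

lemma bounded_opsI:
  "(\<And>c x. blinfun_apply A (c *\<^sub>C x) = c *\<^sub>C blinfun_apply A x) \<Longrightarrow> A \<in> bounded_ops"
  by (simp add: bounded_ops_def)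

lemma bounded_opsD: "A \<in> bounded_ops \<Longrightarrow> A (c *\<^sub>C x) = c *\<^sub>C A x"
  by (simp add: bounded_ops_def)

lemma bounded_ops_id: "id_blinfun \<in> bounded_ops"
  by (simp add: bounded_ops_def)

lemma bounded_ops_zero: "0 \<in> bounded_ops"
  by (simp add: bounded_ops_def scaleC_zero_right)

lemma bounded_ops_add: "A \<in> bounded_ops \<Longrightarrow> B \<in> bounded_ops \<Longrightarrow> A + B \<in> bounded_ops"
  by (simp add: bounded_ops_def blinfun.add_left scaleC_add_right)

lemma bounded_ops_diff: "A \<in> bounded_ops \<Longrightarrow> B \<in> bounded_ops \<Longrightarrow> A - B \<in> bounded_ops"
  by (simp add: bounded_ops_def blinfun.diff_left scaleC_diff_right)

lemma bounded_ops_op_scale: "A \<in> bounded_ops \<Longrightarrow> op_scale c A \<in> bounded_ops"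
  by (simp add: bounded_ops_def scaleC_scaleC mult.commute)

lemma bounded_ops_compose: "A \<in> bounded_ops \<Longrightarrow> B \<in> bounded_ops \<Longrightarrow> A o\<^sub>L B \<in> bounded_ops"
  by (simp add: bounded_ops_def)

lemma scaleR_eq_op_scale: "r *\<^sub>R A = op_scale (complex_of_real r) A"
  by (rule blinfun_eqI) (simp add: blinfun.scaleR_left scaleR_scaleC)

lemma bounded_ops_scaleR: "A \<in> bounded_ops \<Longrightarrow> r *\<^sub>R A \<in> bounded_ops"
  by (simp add: scaleR_eq_op_scale bounded_ops_op_scale)

lemmas bounded_ops_intros = bounded_ops_id bounded_ops_zero bounded_ops_add bounded_ops_diff
  bounded_ops_op_scale bounded_ops_compose bounded_ops_scaleR

lemma tendsto_blinfun_apply: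
  "(A \<longlongrightarrow> L) F \<Longrightarrow> ((\<lambda>n. blinfun_apply (A n) x) \<longlongrightarrow> blinfun_apply L x) F"
  by (intro blinfun.tendsto tendsto_const)

lemma op_scale_one: "op_scale 1 A = A"
  by (rule blinfun_eqI) (simp add: scaleC_one)

lemma op_scale_op_scale: "op_scale c (op_scale d A) = op_scale (c * d) A"
  by (rule blinfun_eqI) (simp add: scaleC_scaleC)

lemma op_scale_add_right: "op_scale c (A + B) = op_scale c A + op_scale c B"
  by (rule blinfun_eqI) (simp add: blinfun.add_left scaleC_add_right)

lemma op_scale_add_left: "op_scale (c + d) A = op_scale c A + op_scale d A"
  by (rule blinfun_eqI) (simp add: blinfun.add_left scaleC_add_left)

lemma op_scale_minus_left: "op_scale (- c) A = - op_scale c A"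
  by (rule blinfun_eqI) (simp add: blinfun.minus_left scaleC_minus_left)

lemma op_scale_zero_left: "op_scale 0 A = 0"
  by (rule blinfun_eqI) (simp add: scaleC_zero_left)

lemma compose_op_scale_left: "op_scale c A o\<^sub>L B = op_scale c (A o\<^sub>L B)"
  by (rule blinfun_eqI) simp

lemma compose_op_scale_right: "A \<in> bounded_ops \<Longrightarrow> A o\<^sub>L op_scale c B = op_scale c (A o\<^sub>L B)"
  by (rule blinfun_eqI) (simp add: bounded_opsD)

lemma compose_assoc: "(A o\<^sub>L B) o\<^sub>L C = A o\<^sub>L (B o\<^sub>L C)"
  by (rule blinfun_eqI) simp

lemma compose_id_left [simp]: "id_blinfun o\<^sub>L A = A"
  by (rule blinfun_eqI) simp

lemma compose_id_right [simp]: "A o\<^sub>L id_blinfun = A"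
  by (rule blinfun_eqI) simp

lemmas compose_simps =
  bounded_bilinear.add_left[OF bounded_bilinear_blinfun_compose]
  bounded_bilinear.add_right[OF bounded_bilinear_blinfun_compose]
  bounded_bilinear.diff_left[OF bounded_bilinear_blinfun_compose]
  bounded_bilinear.diff_right[OF bounded_bilinear_blinfun_compose]
  bounded_bilinear.minus_left[OF bounded_bilinear_blinfun_compose]
  bounded_bilinear.minus_right[OF bounded_bilinear_blinfun_compose]
  bounded_bilinear.scaleR_left[OF bounded_bilinear_blinfun_compose]
  bounded_bilinear.scaleR_right[OF bounded_bilinear_blinfun_compose]

text \<open>The defining equation fixes \<open>B\<close> because the inner product separates
  vectors. Adjoints are computed below by exhibiting a candidate and applying this rule.\<close>

lemma adjoint_op_eqI:
  fixes A B :: "'h::complex_hilbert oper"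
  assumes "B \<in> bounded_ops" "\<And>x y. cinner (A x) y = cinner x (B y)"
  shows "adjoint_op A = B"
  unfolding adjoint_op_def
proof (rule the_equality)
  fix C assume C: "C \<in> bounded_ops \<and> (\<forall>x y. cinner (A x) y = cinner x (C y))"
  show "C = B"
    by (rule blinfun_eqI, rule cinner_ext) (metis C assms(2))
qed (use assms in auto)

text \<open>Riesz representation of \<open>x \<mapsto> cinner (A x) y\<close> gives the value at
  each \<open>y\<close>; boundedness follows from
  \<open>(norm (B y))^2 = cmod (cinner (A (B y)) y)\<close> after cancelling one factor
  \<open>norm (B y)\<close>.\<close>

lemma adjoint_op_exists:
  assumes A: "A \<in> bounded_ops"
  shows "\<exists>B\<in>bounded_ops. \<forall>x y. cinner (A x) y = cinner x (B y)"
proof -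
  have "\<exists>z. \<forall>x. cinner (A x) y = cinner x z" for y
  proof (rule riesz_representation)
    show "cmod (cinner (A x) y) \<le> norm x * (norm A * norm y)" for x
    proof -
      have "cmod (cinner (A x) y) \<le> norm (A x) * norm y" by (rule cinner_Cauchy_Schwarz)
      also have "\<dots> \<le> (norm A * norm x) * norm y"
        by (intro mult_right_mono norm_blinfun) simp
      finally show ?thesis by (simp add: algebra_simps)
    qed
  qed (simp_all add: blinfun.add_right cinner_add_left bounded_opsD[OF A] cinner_scaleC_left)
  then obtain B where B: "\<And>x y. cinner (A x) y = cinner x (B y)" by metis
  have lin: "B (x + y) = B x + B y" "B (c *\<^sub>C x) = c *\<^sub>C B x" for c x y
    by (rule cinner_ext, simp add: B[symmetric] cinner_add_right cinner_scaleC_right)+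
  have "bounded_linear B"
  proof (rule bounded_linear_intro)
    show "B (x + y) = B x + B y" "B (r *\<^sub>R x) = r *\<^sub>R B x" for r x y
      by (simp_all add: lin scaleR_scaleC)
    show "norm (B y) \<le> norm y * norm A" for y
    proof (cases "B y = 0")
      case False
      have "(norm (B y))\<^sup>2 = cmod (cinner (A (B y)) y)"
        by (simp add: B cinner_self norm_power)
      also have "\<dots> \<le> norm (A (B y)) * norm y" by (rule cinner_Cauchy_Schwarz)
      also have "\<dots> \<le> (norm A * norm (B y)) * norm y"
        by (intro mult_right_mono norm_blinfun) simp
      finally have "norm (B y) * norm (B y) \<le> norm (B y) * (norm y * norm A)"
        by (simp add: power2_eq_square algebra_simps)
      then show ?thesis using False by simp
    qed simp
  qed
  then have "blinfun_apply (Blinfun B) = B" by (rule bounded_linear_Blinfun_apply)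
  then show ?thesis
    by (intro bexI[of _ "Blinfun B"] bounded_opsI) (simp_all add: B lin)
qed

lemma
  assumes "A \<in> bounded_ops"
  shows adjoint_op_bounded: "adjoint_op A \<in> bounded_ops"
    and cinner_adjoint_right: "cinner (A x) y = cinner x (adjoint_op A y)"
proof -
  obtain B where B: "B \<in> bounded_ops" "\<And>x y. cinner (A x) y = cinner x (B y)"
    using adjoint_op_exists[OF assms] by blast
  then have "adjoint_op A = B" by (rule adjoint_op_eqI)
  then show "adjoint_op A \<in> bounded_ops" "cinner (A x) y = cinner x (adjoint_op A y)"
    using B by auto
qed

lemma cinner_adjoint_left:
  assumes "A \<in> bounded_ops"
  shows "cinner (adjoint_op A x) y = cinner x (A y)"
  using cinner_adjoint_right[OF assms, of y x] cinner_commute[of "adjoint_op A x" y]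
    cinner_commute[of x "A y"] by simp

lemma adjoint_op_adjoint_op: "A \<in> bounded_ops \<Longrightarrow> adjoint_op (adjoint_op A) = A"
  by (rule adjoint_op_eqI) (simp_all add: cinner_adjoint_left)

lemma adjoint_op_add:
  "A \<in> bounded_ops \<Longrightarrow> B \<in> bounded_ops \<Longrightarrow> adjoint_op (A + B) = adjoint_op A + adjoint_op B"
  by (rule adjoint_op_eqI) (simp_all add: bounded_ops_add adjoint_op_bounded blinfun.add_left
      cinner_add_left cinner_add_right cinner_adjoint_right)

lemma adjoint_op_diff:
  "A \<in> bounded_ops \<Longrightarrow> B \<in> bounded_ops \<Longrightarrow> adjoint_op (A - B) = adjoint_op A - adjoint_op B"
  by (rule adjoint_op_eqI) (simp_all add: bounded_ops_diff adjoint_op_bounded blinfun.diff_left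
      cinner_diff_left cinner_diff_right cinner_adjoint_right)

lemma adjoint_op_scale:
  "A \<in> bounded_ops \<Longrightarrow> adjoint_op (op_scale c A) = op_scale (cnj c) (adjoint_op A)"
  by (rule adjoint_op_eqI) (simp_all add: bounded_ops_op_scale adjoint_op_bounded
      cinner_scaleC_left cinner_scaleC_right cinner_adjoint_right)

lemma adjoint_op_compose:
  "A \<in> bounded_ops \<Longrightarrow> B \<in> bounded_ops \<Longrightarrow> adjoint_op (A o\<^sub>L B) = adjoint_op B o\<^sub>L adjoint_op A"
  by (rule adjoint_op_eqI) (simp_all add: bounded_ops_compose adjoint_op_bounded cinner_adjoint_right)

lemma adjoint_op_id: "adjoint_op id_blinfun = id_blinfun"
  by (rule adjoint_op_eqI) (simp_all add: bounded_ops_id)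

text \<open>Complex linearity is included because \<open>adjoint_op\<close> is a definite
  description, which is unspecified for a map that is only real-linear.\<close>

definition selfadjoint :: "'h::complex_hilbert oper \<Rightarrow> bool" where
  "selfadjoint A \<longleftrightarrow> A \<in> bounded_ops \<and> adjoint_op A = A"

lemma selfadjointD:
  assumes "selfadjoint A"
  shows "A \<in> bounded_ops" "adjoint_op A = A" "cinner (A x) y = cinner x (A y)"
  using assms cinner_adjoint_right[of A x y] by (simp_all add: selfadjoint_def)

lemma selfadjointI:
  assumes "A \<in> bounded_ops" "\<And>x y. cinner (A x) y = cinner x (A y)"
  shows "selfadjoint A"
  using assms adjoint_op_eqI by (auto simp: selfadjoint_def)

lemma selfadjoint_cinner_real: "selfadjoint A \<Longrightarrow> cinner (A x) x \<in> \<real>"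
  using selfadjointD(3)[of A x x] cinner_commute[of "A x" x] by (simp add: Reals_cnj_iff)

lemma selfadjoint_id: "selfadjoint id_blinfun"
  by (simp add: selfadjoint_def bounded_ops_id adjoint_op_id)

lemma selfadjoint_add: "selfadjoint A \<Longrightarrow> selfadjoint B \<Longrightarrow> selfadjoint (A + B)"
  by (simp add: selfadjoint_def adjoint_op_add bounded_ops_add)

lemma selfadjoint_diff: "selfadjoint A \<Longrightarrow> selfadjoint B \<Longrightarrow> selfadjoint (A - B)"
  by (simp add: selfadjoint_def adjoint_op_diff bounded_ops_diff)

lemma selfadjoint_scaleR: "selfadjoint A \<Longrightarrow> selfadjoint (r *\<^sub>R A)"
  by (simp add: selfadjoint_def adjoint_op_scale bounded_ops_op_scale scaleR_eq_op_scale)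

lemma positive_op_adjoint_compose:
  assumes "A \<in> bounded_ops"
  shows "positive_op (adjoint_op A o\<^sub>L A)"
  unfolding positive_op_def
  by (simp add: assms adjoint_op_bounded bounded_ops_compose cinner_adjoint_left cinner_self)

lemma selfadjoint_adjoint_compose:
  assumes "A \<in> bounded_ops"
  shows "selfadjoint (adjoint_op A o\<^sub>L A)"
  by (simp add: selfadjoint_def assms adjoint_op_bounded bounded_ops_compose adjoint_op_compose
      adjoint_op_adjoint_op)

section \<open>Invertibility and the spectrum\<close>

definition invertible_op :: "'h::complex_hilbert oper \<Rightarrow> bool" where
  "invertible_op A \<longleftrightarrow> (\<exists>B\<in>bounded_ops. B o\<^sub>L A = id_blinfun \<and> A o\<^sub>L B = id_blinfun)"

lemma op_spectrum_iff: "c \<in> op_spectrum A \<longleftrightarrow> \<not> invertible_op (A - op_scale c id_blinfun)"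
  by (simp add: op_spectrum_def invertible_op_def)

lemma invertible_op_compose:
  assumes "invertible_op A" "invertible_op B"
  shows "invertible_op (A o\<^sub>L B)"
proof -
  obtain C D where C: "C \<in> bounded_ops" "C o\<^sub>L A = id_blinfun" "A o\<^sub>L C = id_blinfun"
    and D: "D \<in> bounded_ops" "D o\<^sub>L B = id_blinfun" "B o\<^sub>L D = id_blinfun"
    using assms by (auto simp: invertible_op_def)
  have "(D o\<^sub>L C) o\<^sub>L (A o\<^sub>L B) = D o\<^sub>L ((C o\<^sub>L A) o\<^sub>L B)"
    "(A o\<^sub>L B) o\<^sub>L (D o\<^sub>L C) = A o\<^sub>L ((B o\<^sub>L D) o\<^sub>L C)"
    by (simp_all only: compose_assoc)
  then have "(D o\<^sub>L C) o\<^sub>L (A o\<^sub>L B) = id_blinfun" "(A o\<^sub>L B) o\<^sub>L (D o\<^sub>L C) = id_blinfun"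
    by (simp_all add: C D)
  then show ?thesis
    using C D by (auto simp: invertible_op_def intro!: bexI[of _ "D o\<^sub>L C"] bounded_ops_compose)
qed

lemma invertible_op_bounded_below:
  assumes "invertible_op A"
  shows "\<exists>c>0. \<forall>x. c * norm x \<le> norm (A x)"
proof -
  obtain B where B: "B o\<^sub>L A = id_blinfun" using assms by (auto simp: invertible_op_def)
  \<comment> \<open>Adding 1 keeps the constant positive even if \<open>B = 0\<close>.\<close>
  have "norm x \<le> (norm B + 1) * norm (A x)" for x
  proof -
    have "norm x = norm (B (A x))"
      by (metis B blinfun_apply_blinfun_compose blinfun_apply_id_blinfun)
    also have "\<dots> \<le> norm B * norm (A x)" by (rule norm_blinfun)
    finally show ?thesis using norm_ge_zero[of "A x"] unfolding distrib_right by linarith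
  qed
  then show ?thesis
    by (intro exI[of _ "inverse (norm B + 1)"] conjI allI)
      (simp_all add: add_nonneg_pos inverse_eq_divide pos_divide_le_eq mult.commute)
qed

text \<open>For small \<open>e > 0\<close> the map \<open>x \<mapsto> x - e (A x - y)\<close> is a contraction, and its fixed point solves
  \<open>A x = y\<close>.\<close>

lemma coercive_imp_invertible:
  assumes A: "A \<in> bounded_ops" and c: "0 < c"
    and coer: "\<And>x. c * (norm x)\<^sup>2 \<le> Re (cinner (A x) x)"
  shows "invertible_op A"
proof -
  define M where "M = norm A + c"
  have M: "M > 0" using c by (simp add: M_def add_nonneg_pos)
  have below: "c * norm x \<le> norm (A x)" for x
  proof (cases "x = 0")
    case False
    have "c * (norm x)\<^sup>2 \<le> cmod (cinner (A x) x)"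
      using coer[of x] complex_Re_le_cmod[of "cinner (A x) x"] by linarith
    also have "\<dots> \<le> norm (A x) * norm x" by (rule cinner_Cauchy_Schwarz)
    finally show ?thesis using False by (simp add: power2_eq_square)
  qed simp
  \<comment> \<open>This \<open>e\<close> minimises \<open>1 - 2 * e * c + e^2 * M^2\<close>, the
    bound on the squared contraction factor, and \<open>k\<close> is the minimum. The choice
    \<open>M = norm A + c\<close> ensures \<open>c \<le> M\<close>, hence
    \<open>0 \<le> k\<close>.\<close>
  define e where "e = c / M\<^sup>2"
  define k where "k = 1 - c\<^sup>2 / M\<^sup>2"
  have cM: "c\<^sup>2 \<le> M\<^sup>2" using c by (intro power_mono) (auto simp: M_def)
  have k: "0 \<le> k" "k < 1" using c M cM by (auto simp: k_def)
  have contr: "(norm (x - e *\<^sub>R A x))\<^sup>2 \<le> k * (norm x)\<^sup>2" for x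
  proof -
    have "norm (A x) \<le> M * norm x"
      using norm_blinfun[of A x] c mult_nonneg_nonneg[of c "norm x"]
      unfolding M_def distrib_right by (smt (verit) norm_ge_zero)
    then have "(norm (A x))\<^sup>2 \<le> M\<^sup>2 * (norm x)\<^sup>2"
      by (metis norm_ge_zero power_mono power_mult_distrib)
    then have 1: "e\<^sup>2 * (norm (A x))\<^sup>2 \<le> e\<^sup>2 * (M\<^sup>2 * (norm x)\<^sup>2)"
      by (rule mult_left_mono) simp
    have e: "e > 0" using c M by (simp add: e_def)
    have 2: "2 * e * (c * (norm x)\<^sup>2) \<le> 2 * e * Re (cinner (A x) x)"
      using e coer[of x] by (intro mult_left_mono) auto
    have "(norm (x - e *\<^sub>R A x))\<^sup>2
        = (norm x)\<^sup>2 - 2 * e * Re (cinner (A x) x) + e\<^sup>2 * (norm (A x))\<^sup>2"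
      using Re_cinner_commute[of x "A x"]
      by (simp add: norm_diff_power2 cinner_scaleR_right power_mult_distrib)
    also have "\<dots> \<le> (norm x)\<^sup>2 - 2 * e * (c * (norm x)\<^sup>2) + e\<^sup>2 * (M\<^sup>2 * (norm x)\<^sup>2)"
      using 1 2 by linarith
    also have "\<dots> = k * (norm x)\<^sup>2"
      using M by (simp add: e_def k_def field_simps power2_eq_square)
    finally show ?thesis .
  qed
  have ex: "\<exists>!x. A x = y" for y
  proof -
    have "\<exists>!x. x - e *\<^sub>R (A x - y) = x"
    proof (rule banach_fix_type[of "sqrt k"])
      show "0 \<le> sqrt k" "sqrt k < 1" using k by auto
      show "\<forall>u v. dist (u - e *\<^sub>R (A u - y)) (v - e *\<^sub>R (A v - y)) \<le> sqrt k * dist u v"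
      proof (intro allI)
        fix u v
        have "norm ((u - v) - e *\<^sub>R A (u - v)) \<le> sqrt k * norm (u - v)"
          using real_le_rsqrt[OF contr[of "u - v"]] by (simp add: real_sqrt_mult)
        moreover have "(u - e *\<^sub>R (A u - y)) - (v - e *\<^sub>R (A v - y)) = (u - v) - e *\<^sub>R A (u - v)"
          by (simp add: blinfun.diff_right algebra_simps)
        ultimately show "dist (u - e *\<^sub>R (A u - y)) (v - e *\<^sub>R (A v - y)) \<le> sqrt k * dist u v"
          by (simp only: dist_norm)
      qed
    qed
    moreover have "x - e *\<^sub>R (A x - y) = x \<longleftrightarrow> A x = y" for x
      using c M by (simp add: e_def)
    ultimately show ?thesis by simp
  qed
  define B where "B y = (THE x. A x = y)" for y
  have AB: "A (B y) = y" for y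
    unfolding B_def by (rule theI'[OF ex])
  have BA: "B (A x) = x" for x
    using ex[of "A x"] AB[of "A x"] by blast
  have lin: "B (x + y) = B x + B y" "B (a *\<^sub>C x) = a *\<^sub>C B x" for a x y
    by (metis AB BA blinfun.add_right, metis AB BA bounded_opsD[OF A])
  have "bounded_linear B"
  proof (rule bounded_linear_intro)
    show "B (x + y) = B x + B y" "B (r *\<^sub>R x) = r *\<^sub>R B x" for r x y
      by (simp_all add: lin scaleR_scaleC)
    show "norm (B y) \<le> norm y * (1 / c)" for y
      using below[of "B y"] c by (simp add: AB field_simps)
  qed
  then have ap: "blinfun_apply (Blinfun B) = B" by (rule bounded_linear_Blinfun_apply)
  show ?thesis
    unfolding invertible_op_def
    by (intro bexI[of _ "Blinfun B"] conjI blinfun_eqI bounded_opsI)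
      (simp_all add: ap AB BA lin)
qed

text \<open>The hypotheses yield a left inverse \<open>C o\<^sub>L S\<close> and a right inverse
  \<open>S o\<^sub>L D\<close> of \<open>T\<close>, and these must coincide. It is applied with
  \<open>S\<close> the adjoint of \<open>T\<close>, where both products are coercive.\<close>

lemma invertible_op_if_sides:
  assumes T: "T \<in> bounded_ops" and S: "S \<in> bounded_ops"
    and "invertible_op (S o\<^sub>L T)" "invertible_op (T o\<^sub>L S)"
  shows "invertible_op T"
proof -
  obtain C where C: "C \<in> bounded_ops" "C o\<^sub>L (S o\<^sub>L T) = id_blinfun"
    using assms by (auto simp: invertible_op_def)
  obtain D where D: "D \<in> bounded_ops" "(T o\<^sub>L S) o\<^sub>L D = id_blinfun"
    using assms by (auto simp: invertible_op_def)
  have l: "(C o\<^sub>L S) o\<^sub>L T = id_blinfun" and r: "T o\<^sub>L (S o\<^sub>L D) = id_blinfun"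
    using C D by (simp_all add: compose_assoc)
  have "C o\<^sub>L S = (C o\<^sub>L S) o\<^sub>L (T o\<^sub>L (S o\<^sub>L D))" by (simp add: r)
  also have "\<dots> = ((C o\<^sub>L S) o\<^sub>L T) o\<^sub>L (S o\<^sub>L D)" by (simp only: compose_assoc)
  finally have "C o\<^sub>L S = S o\<^sub>L D" by (simp add: l)
  then show ?thesis
    unfolding invertible_op_def using l r S D
    by (intro bexI[of _ "S o\<^sub>L D"]) (auto intro: bounded_ops_compose)
qed

text \<open>Splitting off the real part of \<open>w\<close>, the cross term in the square of
  \<open>norm (A x - w *\<^sub>C x)\<close> vanishes and \<open>(Im w)^2 * (norm x)^2\<close>
  remains as a lower bound. Used for \<open>z\<close> and for \<open>cnj z\<close>, it makes both
  products of \<open>A - z\<close> with its adjoint coercive.\<close>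

lemma selfadjoint_spectrum_real:
  assumes A: "selfadjoint A" and z: "z \<in> op_spectrum A"
  shows "z \<in> \<real>"
proof (rule ccontr)
  assume nz: "z \<notin> \<real>"
  then have b: "Im z \<noteq> 0" by (simp add: complex_is_Real_iff)
  have Ab: "A \<in> bounded_ops" using A by (rule selfadjointD)
  have ge: "(Im w)\<^sup>2 * (norm x)\<^sup>2 \<le> (norm ((A - op_scale w id_blinfun) x))\<^sup>2" for w x
  proof -
    let ?y = "A x - Re w *\<^sub>R x"
    have "selfadjoint (A - Re w *\<^sub>R id_blinfun)"
      using A by (intro selfadjoint_diff selfadjoint_scaleR selfadjoint_id)
    then have "cinner ?y x \<in> \<real>"
      using selfadjoint_cinner_real[of "A - Re w *\<^sub>R id_blinfun" x]
      by (simp add: blinfun.diff_left blinfun.scaleR_left)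
    then have im: "Im (cinner ?y x) = 0" by (simp add: complex_is_Real_iff)
    have "A x - w *\<^sub>C x = ?y - (\<i> * of_real (Im w)) *\<^sub>C x"
      using scaleC_add_left[of "of_real (Re w)" "\<i> * of_real (Im w)" x]
      by (simp add: scaleR_scaleC complex_eq[symmetric])
    moreover have "(norm (?y - (\<i> * of_real (Im w)) *\<^sub>C x))\<^sup>2 = (norm ?y)\<^sup>2 + (Im w)\<^sup>2 * (norm x)\<^sup>2"
      using im by (simp add: norm_diff_power2 cinner_scaleC_right norm_scaleC norm_mult
          power_mult_distrib)
    ultimately have "(norm (A x - w *\<^sub>C x))\<^sup>2 = (norm ?y)\<^sup>2 + (Im w)\<^sup>2 * (norm x)\<^sup>2"
      by (simp only:)
    then show ?thesis by (simp add: blinfun.diff_left)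
  qed
  let ?T = "A - op_scale z id_blinfun" and ?S = "A - op_scale (cnj z) id_blinfun"
  have T: "?T \<in> bounded_ops" "?S \<in> bounded_ops" using Ab by (auto intro: bounded_ops_intros)
  have adj: "adjoint_op ?T = ?S" "adjoint_op ?S = ?T"
    using A by (simp_all add: adjoint_op_diff Ab bounded_ops_intros adjoint_op_scale adjoint_op_id
        selfadjointD)
  have "invertible_op (?S o\<^sub>L ?T)"
  proof (rule coercive_imp_invertible)
    show "(Im z)\<^sup>2 * (norm x)\<^sup>2 \<le> Re (cinner ((?S o\<^sub>L ?T) x) x)" for x
      using ge[of z x] cinner_adjoint_left[OF T(1), of "?T x" x] by (simp add: adj cinner_self)
  qed (use T b in \<open>auto intro: bounded_ops_compose\<close>)
  moreover have "invertible_op (?T o\<^sub>L ?S)"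
  proof (rule coercive_imp_invertible)
    show "(Im z)\<^sup>2 * (norm x)\<^sup>2 \<le> Re (cinner ((?T o\<^sub>L ?S) x) x)" for x
      using ge[of "cnj z" x] cinner_adjoint_left[OF T(2), of "?S x" x] by (simp add: adj cinner_self)
  qed (use T b in \<open>auto intro: bounded_ops_compose\<close>)
  ultimately have "invertible_op ?T" by (rule invertible_op_if_sides[OF T])
  then show False using z by (simp add: op_spectrum_iff)
qed

section \<open>Polynomials in an operator\<close>

lemma op_poly_upto:
  assumes "degree q \<le> n"
  shows "op_poly q A = (\<Sum>i\<le>n. coeff q i *\<^sub>R op_pow A i)"
  unfolding op_poly_def using assms
  by (intro sum.mono_neutral_left) (auto simp: coeff_eq_0)

lemma op_poly_0 [simp]: "op_poly 0 A = 0"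
  by (simp add: op_poly_def)

text \<open>Horner's recursion replaces the defining sum, so that the algebraic rules follow by
  induction on the polynomial.\<close>

lemma op_poly_pCons: "op_poly (pCons a q) A = a *\<^sub>R id_blinfun + (A o\<^sub>L op_poly q A)"
proof -
  have "op_poly (pCons a q) A = (\<Sum>i\<le>Suc (degree q). coeff (pCons a q) i *\<^sub>R op_pow A i)"
    by (rule op_poly_upto) (simp add: degree_pCons_le)
  also have "\<dots> = a *\<^sub>R id_blinfun + (\<Sum>i\<le>degree q. coeff q i *\<^sub>R (A o\<^sub>L op_pow A i))"
    by (simp add: sum.atMost_Suc_shift del: sum.atMost_Suc)
  also have "(\<Sum>i\<le>degree q. coeff q i *\<^sub>R (A o\<^sub>L op_pow A i)) = A o\<^sub>L op_poly q A"
    by (simp add: op_poly_def compose_simps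
        bounded_bilinear.sum_right[OF bounded_bilinear_blinfun_compose])
  finally show ?thesis .
qed

lemma op_poly_add: "op_poly (p + q) A = op_poly p A + op_poly q A"
  by (induction p q rule: poly_induct2)
    (simp_all add: op_poly_pCons compose_simps scaleR_left_distrib)

lemma op_poly_smult: "op_poly (smult a q) A = a *\<^sub>R op_poly q A"
  by (induction q) (simp_all add: op_poly_pCons compose_simps scaleR_right_distrib)

lemma op_poly_diff: "op_poly (p - q) A = op_poly p A - op_poly q A"
  using op_poly_add[of p "smult (-1) q" A] op_poly_smult[of "-1" q A] by simp

lemma op_poly_mult: "op_poly (p * q) A = op_poly p A o\<^sub>L op_poly q A"
proof (induction p)
  case (pCons a p)
  then show ?case
    by (simp add: op_poly_add op_poly_smult op_poly_pCons compose_simps compose_assoc)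
qed simp

lemma op_poly_const: "op_poly [:a:] A = a *\<^sub>R id_blinfun"
  by (simp add: op_poly_pCons)

lemma selfadjoint_op_poly:
  assumes A: "selfadjoint A"
  shows "selfadjoint (op_poly q A)"
proof (induction q)
  case 0
  then show ?case using selfadjoint_scaleR[OF A, of 0] by simp
next
  case (pCons a q)
  have comm: "op_poly q A o\<^sub>L A = A o\<^sub>L op_poly q A"
  proof (induction q)
    case (pCons b q)
    then show ?case by (simp add: op_poly_pCons compose_simps compose_assoc)
  qed simp
  have "selfadjoint (A o\<^sub>L op_poly q A)"
    using A pCons comm by (simp add: selfadjoint_def bounded_ops_compose adjoint_op_compose)
  then show ?case
    by (simp add: op_poly_pCons selfadjoint_add selfadjoint_scaleR selfadjoint_id)
qed

text \<open>Real polynomials need not split into real linear factors, so complex coefficients are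
  needed to locate roots in the spectrum. Horner's scheme is taken as the definition.\<close>

definition cop_poly :: "complex poly \<Rightarrow> 'h::complex_hilbert oper \<Rightarrow> 'h oper" where
  "cop_poly q A = fold_coeffs (\<lambda>a B. op_scale a id_blinfun + (A o\<^sub>L B)) q 0"

lemma cop_poly_0 [simp]: "cop_poly 0 A = 0"
  by (simp add: cop_poly_def)

lemma cop_poly_pCons: "cop_poly (pCons a q) A = op_scale a id_blinfun + (A o\<^sub>L cop_poly q A)"
  by (cases "a = 0 \<and> q = 0") (auto simp: cop_poly_def op_scale_zero_left)

lemma cop_poly_add: "cop_poly (p + q) A = cop_poly p A + cop_poly q A"
  by (induction p q rule: poly_induct2)
    (simp_all add: cop_poly_pCons compose_simps op_scale_add_left)

lemma op_scale_zero_right: "op_scale c 0 = 0"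
  by (rule blinfun_eqI) (simp add: scaleC_zero_right)

lemma cop_poly_smult:
  assumes "A \<in> bounded_ops"
  shows "cop_poly (smult a q) A = op_scale a (cop_poly q A)"
  by (induction q) (simp_all add: cop_poly_pCons op_scale_zero_right op_scale_add_right
      op_scale_op_scale compose_op_scale_right assms)

lemma cop_poly_of_real: "cop_poly (map_poly complex_of_real q) A = op_poly q A"
  by (induction q) (simp_all add: map_poly_pCons cop_poly_pCons op_poly_pCons scaleR_eq_op_scale)

lemma cop_poly_linear_mult:
  assumes A: "A \<in> bounded_ops"
  shows "cop_poly ([:-z, 1:] * q) A = (A - op_scale z id_blinfun) o\<^sub>L cop_poly q A"
proof -
  have "[:-z, 1:] * q = smult (- z) q + pCons 0 q" by simp
  then show ?thesis
    by (simp only: cop_poly_add cop_poly_smult[OF A] cop_poly_pCons)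
      (simp add: compose_simps op_scale_minus_left op_scale_zero_left compose_op_scale_left)
qed

lemma invertible_op_scale_id:
  assumes "c \<noteq> 0"
  shows "invertible_op (op_scale c id_blinfun :: 'h::complex_hilbert oper)"
  unfolding invertible_op_def
  by (rule bexI[of _ "op_scale (1 / c) id_blinfun"])
    (use assms in \<open>simp_all add: compose_op_scale_left op_scale_op_scale op_scale_one
      bounded_ops_op_scale bounded_ops_id\<close>)

text \<open>One half of the spectral mapping theorem: over the complex numbers \<open>q\<close>
  splits into linear factors, and each factor \<open>A - z\<close> is invertible because its root
  lies off the spectrum.\<close>

lemma cop_poly_invertible:
  assumes A: "A \<in> bounded_ops"
  shows "q \<noteq> 0 \<Longrightarrow> (\<And>z. poly q z = 0 \<Longrightarrow> z \<notin> op_spectrum A) \<Longrightarrow> invertible_op (cop_poly q A)"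
proof (induction "degree q" arbitrary: q)
  case 0
  then obtain a where q: "q = [:a:]" using degree_eq_zeroE by metis
  then show ?case using 0 by (simp add: cop_poly_pCons invertible_op_scale_id)
next
  case (Suc n)
  then have "\<not> constant (poly q)" by (simp add: constant_degree)
  then obtain z where z: "poly q z = 0" using fundamental_theorem_of_algebra by blast
  then obtain s where s: "q = [:-z, 1:] * s" by (metis dvdE poly_eq_0_iff_dvd)
  have s0: "s \<noteq> 0" using Suc.prems(1) s by auto
  then have "degree q = Suc (degree s)" using s by (subst s) (simp add: degree_mult_eq del: mult_pCons_left)
  then have "invertible_op (cop_poly s A)"
    using Suc.hyps s0 by (intro Suc.hyps(1)) (auto intro!: Suc.prems(2) simp: s)
  moreover have "invertible_op (A - op_scale z id_blinfun)"
    using Suc.prems(2)[OF z] by (simp add: op_spectrum_iff)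
  ultimately show ?case
    unfolding s cop_poly_linear_mult[OF A] by (intro invertible_op_compose)
qed

text \<open>With \<open>m = norm T\<close>, a lower bound \<open>c\<close> for
  \<open>T^2 - m^2\<close> would, after expanding the square, force
  \<open>m^2 * (norm (T x))^2 \<le> (m^4 - c^2) * (norm x)^2\<close> for all \<open>x\<close>, hence
  a norm strictly below \<open>m\<close>.\<close>

lemma selfadjoint_norm_not_bounded_below:
  assumes T: "selfadjoint T" and "T \<noteq> 0"
  shows "\<not> invertible_op ((T o\<^sub>L T) - ((norm T)\<^sup>2) *\<^sub>R id_blinfun)"
proof
  define m where "m = norm T"
  have m: "m > 0" using assms by (simp add: m_def)
  assume "invertible_op ((T o\<^sub>L T) - ((norm T)\<^sup>2) *\<^sub>R id_blinfun)"
  from invertible_op_bounded_below[OF this]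
  obtain c where c: "c > 0" "\<And>x. c * norm x \<le> norm (T (T x) - m\<^sup>2 *\<^sub>R x)"
    by (auto simp: m_def blinfun.diff_left blinfun.scaleR_left)
  have key: "m\<^sup>2 * (norm (T x))\<^sup>2 \<le> (m^4 - c\<^sup>2) * (norm x)\<^sup>2" for x
  proof -
    have "norm (T (T x)) \<le> m * norm (T x)" unfolding m_def by (rule norm_blinfun)
    then have 1: "(norm (T (T x)))\<^sup>2 \<le> m\<^sup>2 * (norm (T x))\<^sup>2"
      by (metis norm_ge_zero power_mono power_mult_distrib)
    have "(c * norm x)\<^sup>2 \<le> (norm (T (T x) - m\<^sup>2 *\<^sub>R x))\<^sup>2"
      using c by (intro power_mono) auto
    also have "\<dots> = (norm (T (T x)))\<^sup>2 - 2 * m\<^sup>2 * (norm (T x))\<^sup>2 + m^4 * (norm x)\<^sup>2"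
    proof -
      have "cinner (T (T x)) x = cinner (T x) (T x)" by (rule selfadjointD(3)[OF T])
      then show ?thesis
        by (simp add: norm_diff_power2 cinner_scaleR_right cinner_self power_mult_distrib
            flip: power_mult)
    qed
    also have "\<dots> \<le> m^4 * (norm x)\<^sup>2 - m\<^sup>2 * (norm (T x))\<^sup>2" using 1 by linarith
    finally show ?thesis by (simp add: power_mult_distrib algebra_simps)
  qed
  \<comment> \<open>The minimum with \<open>m^2\<close> keeps the radicand \<open>m^2 - d\<close>
    nonnegative.\<close>
  define d where "d = min (m\<^sup>2) (c\<^sup>2 / m\<^sup>2)"
  have d: "0 < d" "d \<le> m\<^sup>2" "d \<le> c\<^sup>2 / m\<^sup>2" using m c by (auto simp: d_def)
  have "norm T \<le> sqrt (m\<^sup>2 - d)"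
  proof (rule norm_blinfun_bound)
    show "0 \<le> sqrt (m\<^sup>2 - d)" using d by simp
    fix x
    have "m^4 - c\<^sup>2 = m\<^sup>2 * (m\<^sup>2 - c\<^sup>2 / m\<^sup>2)"
      using m by (simp add: field_simps power2_eq_square power4_eq_xxxx)
    then have "m\<^sup>2 * (norm (T x))\<^sup>2 \<le> m\<^sup>2 * ((m\<^sup>2 - c\<^sup>2 / m\<^sup>2) * (norm x)\<^sup>2)"
      using key[of x] by (simp only: mult.assoc)
    then have "(norm (T x))\<^sup>2 \<le> (m\<^sup>2 - c\<^sup>2 / m\<^sup>2) * (norm x)\<^sup>2"
      using m by (subst (asm) mult_le_cancel_left_pos) auto
    also have "\<dots> \<le> (m\<^sup>2 - d) * (norm x)\<^sup>2" using d by (intro mult_right_mono) auto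
    finally show "norm (T x) \<le> sqrt (m\<^sup>2 - d) * norm x"
      by (metis real_le_rsqrt real_sqrt_mult real_sqrt_abs abs_norm_cancel)
  qed
  also have "\<dots> < sqrt (m\<^sup>2)" using d by (intro real_sqrt_less_mono) simp
  finally show False using m by (simp add: m_def)
qed

text \<open>This is the set on which \<open>cfc\<close> demands uniform convergence. For
  self-adjoint \<open>A\<close> it is the whole spectrum.\<close>

definition real_spectrum :: "'h::complex_hilbert oper \<Rightarrow> real set" where
  "real_spectrum A = {t. complex_of_real t \<in> op_spectrum A}"

text \<open>If \<open>m = \<parallel>T\<parallel>\<close> for a self-adjoint \<open>T = q(A)\<close>, then \<open>T\<^sup>2 - m\<^sup>2\<close> is not bounded below, so one of the
  complex roots of \<open>q\<^sup>2 - m\<^sup>2\<close> lies in the spectrum of \<open>A\<close>.\<close>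

lemma norm_op_poly_attained:
  assumes A: "selfadjoint A" and deg: "degree q \<noteq> 0" and nz: "op_poly q A \<noteq> 0"
  shows "\<exists>t\<in>real_spectrum A. \<bar>poly q t\<bar> = norm (op_poly q A)"
proof -
  define T where "T = op_poly q A"
  define r where "r = q * q - [:(norm T)\<^sup>2:]"
  have Ab: "A \<in> bounded_ops" using A by (rule selfadjointD)
  have "selfadjoint T" unfolding T_def using A by (rule selfadjoint_op_poly)
  then have "\<not> invertible_op ((T o\<^sub>L T) - ((norm T)\<^sup>2) *\<^sub>R id_blinfun)"
    using nz by (intro selfadjoint_norm_not_bounded_below) (auto simp: T_def)
  also have "(T o\<^sub>L T) - ((norm T)\<^sup>2) *\<^sub>R id_blinfun = cop_poly (map_poly complex_of_real r) A"
    by (simp add: cop_poly_of_real r_def op_poly_diff op_poly_mult op_poly_const T_def)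
  finally have ninv: "\<not> invertible_op (cop_poly (map_poly complex_of_real r) A)" .
  \<comment> \<open>Here \<open>deg\<close> enters: for constant \<open>q\<close> the polynomial
    \<open>r\<close> can vanish identically, and its roots would say nothing.\<close>
  have "r \<noteq> 0"
  proof
    assume "r = 0"
    then have "degree (q * q) = 0" by (simp add: r_def)
    then show False using deg degree_mult_eq[of q q] by (cases "q = 0") auto
  qed
  then have "map_poly complex_of_real r \<noteq> 0" by (simp add: map_poly_eq_0_iff)
  then obtain z where z: "poly (map_poly complex_of_real r) z = 0" "z \<in> op_spectrum A"
    using cop_poly_invertible[OF Ab] ninv by blast
  then obtain t where t: "z = complex_of_real t"
    using selfadjoint_spectrum_real[OF A] by (auto elim: Reals_cases)
  have "poly (map_poly complex_of_real r) (complex_of_real t) = complex_of_real (poly r t)"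
    by (induction r) (simp_all add: map_poly_pCons)
  then have "poly r t = 0" "t \<in> real_spectrum A" using z t by (auto simp: real_spectrum_def)
  then have "(poly q t)\<^sup>2 = (norm T)\<^sup>2" by (simp add: r_def power2_eq_square)
  then have "\<bar>poly q t\<bar> = norm T" by (auto simp: power2_eq_iff)
  then show ?thesis using \<open>t \<in> real_spectrum A\<close> by (auto simp: T_def)
qed

lemma real_spectrum_nonempty:
  assumes A: "selfadjoint A" and id: "(id_blinfun :: 'h::complex_hilbert oper) \<noteq> 0"
  shows "real_spectrum (A :: 'h oper) \<noteq> {}"
proof (cases "A = 0")
  case True
  have "\<not> invertible_op (0 :: 'h oper)" using id by (simp add: invertible_op_def)
  then have "0 \<in> real_spectrum A"
    by (simp add: True real_spectrum_def op_spectrum_iff op_scale_zero_left)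
  then show ?thesis by blast
next
  case False
  then show ?thesis
    using norm_op_poly_attained[OF A, of "[:0, 1:]"] by (auto simp: op_poly_pCons)
qed

text \<open>The estimate behind the functional calculus: polynomials uniformly close on the spectrum
  give operators close in norm. Constants are not covered by \<open>norm_op_poly_attained\<close>
  and need a spectral point instead.\<close>

lemma norm_op_poly_le:
  assumes A: "selfadjoint A" and s: "0 \<le> s"
    and bd: "\<And>t. t \<in> real_spectrum A \<Longrightarrow> \<bar>poly q t\<bar> \<le> s"
  shows "norm (op_poly q A) \<le> s"
proof (cases "op_poly q A = 0")
  case nz: False
  show ?thesis
  proof (cases "degree q = 0")
    case True
    then obtain a where q: "q = [:a:]" using degree_eq_zeroE by metis
    then have "op_poly q A = a *\<^sub>R id_blinfun" by (simp add: op_poly_const)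
    moreover from this have "(id_blinfun :: 'a oper) \<noteq> 0" using nz by auto
    then obtain t where "t \<in> real_spectrum A" using real_spectrum_nonempty[OF A] by blast
    then have "\<bar>a\<bar> \<le> s" using bd[of t] q by simp
    moreover have "\<bar>a\<bar> * norm (id_blinfun :: 'a oper) \<le> \<bar>a\<bar> * 1"
      by (intro mult_left_mono norm_blinfun_id_le) simp
    ultimately show ?thesis by simp
  next
    case False
    then show ?thesis using norm_op_poly_attained[OF A False nz] bd by force
  qed
qed (simp add: s)

section \<open>Positive operators\<close>

lemma positive_opI:
  assumes "selfadjoint A" "\<And>x. 0 \<le> Re (cinner (blinfun_apply A x) x)"
  shows "positive_op A"
  using assms by (simp add: positive_op_def selfadjointD(1) selfadjoint_cinner_real)

text \<open>Polarisation: the quadratic form of \<open>D = A - adjoint_op A\<close> vanishes.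
  Replacing \<open>y\<close> by \<open>\<i> *\<^sub>C y\<close> shows that the sesquilinear form of
  \<open>D\<close> is both symmetric and antisymmetric in its two arguments.\<close>

lemma positive_imp_selfadjoint:
  assumes "positive_op A"
  shows "selfadjoint A"
proof (rule selfadjointI)
  show Ab: "A \<in> bounded_ops" using assms by (simp add: positive_op_def)
  define D where "D = A - adjoint_op A"
  have Db: "D \<in> bounded_ops"
    unfolding D_def using Ab by (intro bounded_ops_diff adjoint_op_bounded)
  have diag: "cinner (D x) x = 0" for x
  proof -
    have "cinner (A x) x \<in> \<real>" using assms by (simp add: positive_op_def)
    then have "cinner x (A x) = cinner (A x) x"
      by (metis cinner_commute Reals_cnj_iff)
    then show ?thesis
      by (simp add: D_def blinfun.diff_left cinner_diff_left cinner_adjoint_left[OF Ab])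
  qed
  have sum: "cinner (D x) y + cinner (D y) x = 0" for x y
    using diag[of "x + y"] diag[of x] diag[of y]
    by (simp add: blinfun.add_right cinner_add_left cinner_add_right add.commute)
  have "cinner (D x) y = 0" for x y
  proof -
    have "- \<i> * cinner (D x) y + \<i> * cinner (D y) x = 0"
      using sum[of x "\<i> *\<^sub>C y"]
      by (simp add: cinner_scaleC_left cinner_scaleC_right bounded_opsD[OF Db])
    then have "cinner (D x) y = cinner (D y) x" by simp
    then show ?thesis using sum[of x y] by simp
  qed
  then show "cinner (A x) y = cinner x (A y)" for x y
    using cinner_adjoint_left[OF Ab, of x y]
    by (simp add: D_def blinfun.diff_left cinner_diff_left)
qed

text \<open>For \<open>t < a\<close> the operator \<open>A - t\<close> is coercive with constant
  \<open>a - t\<close>; for \<open>t > b\<close> its negative is coercive with constant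
  \<open>t - b\<close>.\<close>

lemma real_spectrum_bounds:
  assumes A: "selfadjoint A" and t: "t \<in> real_spectrum A"
    and lo: "\<And>x. a * (norm x)\<^sup>2 \<le> Re (cinner (blinfun_apply A x) x)"
    and hi: "\<And>x. Re (cinner (blinfun_apply A x) x) \<le> b * (norm x)\<^sup>2"
  shows "a \<le> t" "t \<le> b"
proof -
  have Ab: "A \<in> bounded_ops" using A by (rule selfadjointD)
  have T: "A - t *\<^sub>R id_blinfun \<in> bounded_ops" using Ab by (intro bounded_ops_intros)
  have ninv: "\<not> invertible_op (A - t *\<^sub>R id_blinfun)"
    using t by (simp add: real_spectrum_def op_spectrum_iff scaleR_eq_op_scale)
  have re: "Re (cinner ((A - t *\<^sub>R id_blinfun) x) x) = Re (cinner (A x) x) - t * (norm x)\<^sup>2" for x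
    by (simp add: blinfun.diff_left blinfun.scaleR_left cinner_diff_left cinner_scaleR_left cinner_self)
  show "a \<le> t"
  proof (rule ccontr)
    assume "\<not> a \<le> t"
    then have "invertible_op (A - t *\<^sub>R id_blinfun)"
      using lo by (intro coercive_imp_invertible[OF T, of "a - t"]) (auto simp: re left_diff_distrib)
    then show False using ninv by blast
  qed
  show "t \<le> b"
  proof (rule ccontr)
    assume tb: "\<not> t \<le> b"
    have "invertible_op (op_scale (- 1) (A - t *\<^sub>R id_blinfun))"
    proof (rule coercive_imp_invertible[of _ "t - b"])
      show "(t - b) * (norm x)\<^sup>2 \<le> Re (cinner (op_scale (- 1) (A - t *\<^sub>R id_blinfun) x) x)" for x
        using hi[of x] re[of x] by (simp add: cinner_scaleC_left left_diff_distrib)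
    qed (use T tb in \<open>auto intro: bounded_ops_op_scale\<close>)
    then have "invertible_op (op_scale (- 1) id_blinfun o\<^sub>L op_scale (- 1) (A - t *\<^sub>R id_blinfun))"
      by (intro invertible_op_compose invertible_op_scale_id) auto
    then show False
      using ninv by (simp add: compose_op_scale_left op_scale_op_scale op_scale_one)
  qed
qed

lemma Re_cinner_le_norm: "Re (cinner (blinfun_apply A x) x) \<le> norm A * (norm x)\<^sup>2"
proof -
  have "Re (cinner (blinfun_apply A x) x) \<le> norm (blinfun_apply A x) * norm x"
    using complex_Re_le_cmod cinner_Cauchy_Schwarz order_trans by blast
  also have "\<dots> \<le> (norm A * norm x) * norm x" by (intro mult_right_mono norm_blinfun) simp
  finally show ?thesis by (simp add: power2_eq_square mult.assoc)
qed

lemma real_spectrum_positive_op: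
  assumes "positive_op A"
  shows "real_spectrum A \<subseteq> {0..norm A}"
  using real_spectrum_bounds[OF positive_imp_selfadjoint[OF assms], of _ 0 "norm A"]
    Re_cinner_le_norm[of A] assms
  by (auto simp: positive_op_def)

lemma real_spectrum_norm:
  assumes "selfadjoint A"
  shows "real_spectrum A \<subseteq> {- norm A..norm A}"
proof -
  have "- norm A * (norm x)\<^sup>2 \<le> Re (cinner (blinfun_apply A x) x)" for x
    using Re_cinner_le_norm[of "- A" x] by (simp add: blinfun.minus_left cinner_minus_left)
  then show ?thesis
    using real_spectrum_bounds[OF assms, of _ "- norm A" "norm A"] Re_cinner_le_norm[of A] by auto
qed

text \<open>If \<open>0 \<le> q \<le> m\<close> on the spectrum, then
  \<open>\<bar>m - q\<bar> \<le> m\<close> there, so \<open>m - q(A)\<close> has norm at most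
  \<open>m\<close> and its quadratic form is at most that of \<open>m\<close>. No square root is
  involved.\<close>

lemma op_poly_positive:
  assumes A: "selfadjoint A" and nn: "\<And>t. t \<in> real_spectrum A \<Longrightarrow> 0 \<le> poly q t"
  shows "positive_op (op_poly q A)"
proof (rule positive_opI)
  show "selfadjoint (op_poly q A)" using A by (rule selfadjoint_op_poly)
  fix x :: 'a
  have "compact {- norm A..norm A}" by simp
  then have "bounded (poly q ` {- norm A..norm A})"
    by (intro compact_imp_bounded compact_continuous_image continuous_intros)
  then obtain m where m: "0 < m" "\<And>t. t \<in> {- norm A..norm A} \<Longrightarrow> \<bar>poly q t\<bar> \<le> m"
    by (auto simp: bounded_pos)
  have "norm (op_poly ([:m:] - q) A) \<le> m"
  proof (rule norm_op_poly_le[OF A])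
    fix t assume t: "t \<in> real_spectrum A"
    then have "\<bar>poly q t\<bar> \<le> m" using real_spectrum_norm[OF A] m by blast
    then show "\<bar>poly ([:m:] - q) t\<bar> \<le> m" using nn[OF t] by simp
  qed (use m in simp)
  then have "norm (op_poly ([:m:] - q) A) * (norm x)\<^sup>2 \<le> m * (norm x)\<^sup>2"
    by (intro mult_right_mono) auto
  then have "Re (cinner (op_poly ([:m:] - q) A x) x) \<le> m * (norm x)\<^sup>2"
    using Re_cinner_le_norm[of "op_poly ([:m:] - q) A" x] by linarith
  then show "0 \<le> Re (cinner (op_poly q A x) x)"
    by (simp add: op_poly_diff op_poly_const blinfun.diff_left blinfun.scaleR_left
        cinner_diff_left cinner_scaleR_left cinner_self)
qed

lemma closed_bounded_ops: "closed bounded_ops"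
proof (rule closed_sequential_limits[THEN iffD2], intro allI impI, elim conjE)
  fix A L assume A: "\<forall>n::nat. A n \<in> bounded_ops" and lim: "A \<longlonglongrightarrow> L"
  show "L \<in> bounded_ops"
  proof (rule bounded_opsI)
    fix c x
    have "(\<lambda>n. blinfun_apply (A n) (c *\<^sub>C x)) \<longlonglongrightarrow> blinfun_apply L (c *\<^sub>C x)"
      by (rule tendsto_blinfun_apply[OF lim])
    moreover have "(\<lambda>n. c *\<^sub>C blinfun_apply (A n) x) \<longlonglongrightarrow> c *\<^sub>C blinfun_apply L x"
      by (intro bounded_linear.tendsto[OF bounded_linear_scaleC] tendsto_blinfun_apply[OF lim])
    ultimately show "blinfun_apply L (c *\<^sub>C x) = c *\<^sub>C blinfun_apply L x"
      using A by (intro LIMSEQ_unique) (simp add: bounded_opsD)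
  qed
qed

text \<open>The correction \<open>e n\<close> is there because polynomial approximants of a
  nonnegative function give positive operators only up to a small multiple of the identity.\<close>

lemma positive_op_limit:
  assumes "A \<longlonglongrightarrow> L" "\<And>n::nat. positive_op (A n + e n *\<^sub>R id_blinfun)" "e \<longlonglongrightarrow> 0"
  shows "positive_op L"
proof -
  define B where "B n = A n + e n *\<^sub>R id_blinfun" for n
  have "B \<longlonglongrightarrow> L + 0 *\<^sub>R id_blinfun"
    unfolding B_def by (intro tendsto_intros assms)
  then have lim: "B \<longlonglongrightarrow> L" by simp
  have B: "positive_op (B n)" for n using assms(2) by (simp add: B_def)
  have "B n \<in> bounded_ops" for n using B by (simp add: positive_op_def)
  then have Lb: "L \<in> bounded_ops" using closed_sequentially[OF closed_bounded_ops] lim by blast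
  have lim_inner: "(\<lambda>n. cinner (blinfun_apply (B n) x) x) \<longlonglongrightarrow> cinner (blinfun_apply L x) x" for x
    by (intro bounded_bilinear.tendsto[OF bounded_bilinear_cinner] tendsto_blinfun_apply[OF lim]
        tendsto_const)
  have "cinner (blinfun_apply L x) x \<in> \<real>" for x
    using B by (intro closed_sequentially[OF closed_complex_Reals _ lim_inner])
      (auto simp: positive_op_def)
  moreover have "0 \<le> Re (cinner (blinfun_apply L x) x)" for x
    using B by (intro LIMSEQ_le_const[OF tendsto_Re[OF lim_inner]]) (auto simp: positive_op_def)
  ultimately show ?thesis using Lb by (simp add: positive_op_def)
qed

section \<open>Continuous functional calculus\<close>

lemma polynomial_approximation:
  fixes f :: "real \<Rightarrow> real"
  assumes "continuous_on {a..b} f"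
  shows "\<exists>q. uniform_limit {a..b} (\<lambda>n. poly (q n)) f sequentially"
proof -
  have "\<exists>q. \<forall>x\<in>{a..b}. \<bar>f x - poly q x\<bar> < 1 / real (Suc n)" for n
  proof -
    obtain g where g: "real_polynomial_function g" "\<And>x. x \<in> {a..b} \<Longrightarrow> \<bar>f x - g x\<bar> < 1 / real (Suc n)"
      using Stone_Weierstrass_real_polynomial_function[OF _ assms, of "1 / real (Suc n)"] by auto
    obtain c k where "g = (\<lambda>x. \<Sum>i\<le>k. c i * x ^ i)"
      using g(1) real_polynomial_function_iff_sum by blast
    then have "g x = poly (\<Sum>i\<le>k. monom (c i) i) x" for x
      by (simp add: poly_sum poly_monom)
    then show ?thesis using g(2) by metis
  qed
  then obtain q where q: "\<And>n x. x \<in> {a..b} \<Longrightarrow> \<bar>f x - poly (q n) x\<bar> < 1 / real (Suc n)"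
    by metis
  have "uniform_limit {a..b} (\<lambda>n. poly (q n)) f sequentially"
  proof (rule uniform_limitI)
    fix e :: real assume "0 < e"
    then obtain M where M: "1 / real (Suc M) < e" using nat_approx_posE by metis
    have "dist (poly (q n) x) (f x) < e" if "n \<ge> M" "x \<in> {a..b}" for n x
    proof -
      have "1 / real (Suc n) \<le> 1 / real (Suc M)" using that by (intro divide_left_mono) auto
      then show ?thesis using q[OF that(2), of n] M by (simp add: dist_real_def abs_minus_commute)
    qed
    then show "\<forall>\<^sub>F n in sequentially. \<forall>x\<in>{a..b}. dist (poly (q n) x) (f x) < e"
      unfolding eventually_sequentially by blast
  qed
  then show ?thesis by blast
qed

text \<open>This resolves the definite description in \<open>cfc\<close>. Any two approximating
  sequences have nearby operators, so they share a limit. Stone-Weierstrass on \<open>{a..b}\<close>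
  provides one such sequence, without which the description would be vacuous and not unique.\<close>

lemma cfc_LIMSEQ:
  assumes A: "selfadjoint A" and spec: "real_spectrum A \<subseteq> {a..b}" and f: "continuous_on {a..b} f"
    and q: "uniform_limit (real_spectrum A) (\<lambda>n. poly (q n)) f sequentially"
  shows "(\<lambda>n. op_poly (q n) A) \<longlonglongrightarrow> cfc f A"
proof -
  let ?S = "real_spectrum A"
  have close: "\<exists>M. \<forall>m\<ge>M. \<forall>n\<ge>M. norm (op_poly (u m) A - op_poly (v n) A) \<le> e"
    if u: "uniform_limit ?S (\<lambda>n. poly (u n)) f sequentially"
      and v: "uniform_limit ?S (\<lambda>n. poly (v n)) f sequentially" and e: "0 < e" for u v e
  proof -
    obtain M where M: "\<And>n x. n \<ge> M \<Longrightarrow> x \<in> ?S \<Longrightarrow> dist (poly (u n) x) (f x) < e / 2"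
      using uniform_limitD[OF u, of "e / 2"] e by (auto simp: eventually_sequentially)
    obtain M' where M': "\<And>n x. n \<ge> M' \<Longrightarrow> x \<in> ?S \<Longrightarrow> dist (poly (v n) x) (f x) < e / 2"
      using uniform_limitD[OF v, of "e / 2"] e by (auto simp: eventually_sequentially)
    have "norm (op_poly (u m - v n) A) \<le> e" if "m \<ge> max M M'" "n \<ge> max M M'" for m n
    proof (rule norm_op_poly_le[OF A])
      fix t assume "t \<in> ?S"
      then have "dist (poly (u m) t) (f t) < e / 2" "dist (poly (v n) t) (f t) < e / 2"
        using M[of m t] M'[of n t] that by simp_all
      then show "\<bar>poly (u m - v n) t\<bar> \<le> e"
        unfolding dist_real_def poly_diff by linarith
    qed (use e in simp)
    then show ?thesis unfolding op_poly_diff by blast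
  qed
  obtain u where "uniform_limit {a..b} (\<lambda>n. poly (u n)) f sequentially"
    using polynomial_approximation[OF f] by blast
  then have u: "uniform_limit ?S (\<lambda>n. poly (u n)) f sequentially"
    using spec by (rule uniform_limit_on_subset)
  have "Cauchy (\<lambda>n. op_poly (u n) A)"
  proof (rule CauchyI)
    fix e :: real assume "0 < e"
    then obtain M where "\<forall>m\<ge>M. \<forall>n\<ge>M. norm (op_poly (u m) A - op_poly (u n) A) \<le> e / 2"
      using close[OF u u, of "e / 2"] by auto
    then show "\<exists>M. \<forall>m\<ge>M. \<forall>n\<ge>M. norm (op_poly (u m) A - op_poly (u n) A) < e"
      using \<open>0 < e\<close> by (intro exI[of _ M]) fastforce
  qed
  then obtain L where L: "(\<lambda>n. op_poly (u n) A) \<longlonglongrightarrow> L"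
    using Cauchy_convergent convergent_def by blast
  have all: "(\<lambda>n. op_poly (v n) A) \<longlonglongrightarrow> L"
    if v: "uniform_limit ?S (\<lambda>n. poly (v n)) f sequentially" for v
  proof -
    have "(\<lambda>n. op_poly (v n) A - op_poly (u n) A) \<longlonglongrightarrow> 0"
    proof (rule LIMSEQ_I)
      fix e :: real assume "0 < e"
      then obtain M where "\<forall>m\<ge>M. \<forall>n\<ge>M. norm (op_poly (v m) A - op_poly (u n) A) \<le> e / 2"
        using close[OF v u, of "e / 2"] by auto
      then show "\<exists>M. \<forall>n\<ge>M. norm (op_poly (v n) A - op_poly (u n) A - 0) < e"
        using \<open>0 < e\<close> by (intro exI[of _ M]) fastforce
    qed
    from tendsto_add[OF this L] show ?thesis by simp
  qed
  have "cfc f A = L"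
    unfolding cfc_def real_spectrum_def[symmetric]
    using all u L LIMSEQ_unique by (intro the_equality) blast+
  then show ?thesis using all[OF q] by simp
qed

text \<open>The constant sequence \<open>q\<close> converges to \<open>f\<close> on the spectrum. On
  a spectrum of one or two points this makes square roots and powers linear.\<close>

lemma cfc_eq_op_poly:
  assumes "selfadjoint A" "real_spectrum A \<subseteq> {a..b}" "continuous_on {a..b} f"
    and "\<And>t. t \<in> real_spectrum A \<Longrightarrow> f t = poly q t"
  shows "cfc f A = op_poly q A"
proof -
  have "uniform_limit (real_spectrum A) (\<lambda>n. poly q) f sequentially"
    using assms(4) by (intro uniform_limitI) simp
  from cfc_LIMSEQ[OF assms(1-3) this] show ?thesis
    using LIMSEQ_unique tendsto_const by blast
qed

lemma cfc_approximation:
  assumes A: "selfadjoint A" and spec: "real_spectrum A \<subseteq> {a..b}" and f: "continuous_on {a..b} f"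
  obtains q where "uniform_limit (real_spectrum A) (\<lambda>n. poly (q n)) f sequentially"
    "(\<lambda>n. op_poly (q n) A) \<longlonglongrightarrow> cfc f A"
  using polynomial_approximation[OF f] uniform_limit_on_subset[OF _ spec] cfc_LIMSEQ[OF A spec f]
  by blast

text \<open>The approximating polynomials may violate the inequality with \<open>r\<close> by an error tending to \<open>0\<close>,
  which disappears in the limit.\<close>

lemma
  assumes A: "selfadjoint A" and spec: "real_spectrum A \<subseteq> {a..b}" and f: "continuous_on {a..b} f"
  shows cfc_minus_op_poly_positive:
      "(\<And>t. t \<in> real_spectrum A \<Longrightarrow> poly r t \<le> f t) \<Longrightarrow> positive_op (cfc f A - op_poly r A)"
    and op_poly_minus_cfc_positive:
      "(\<And>t. t \<in> real_spectrum A \<Longrightarrow> f t \<le> poly r t) \<Longrightarrow> positive_op (op_poly r A - cfc f A)"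
proof -
  obtain q where q: "uniform_limit (real_spectrum A) (\<lambda>n. poly (q n)) f sequentially"
    using cfc_approximation[OF assms] by blast
  \<comment> \<open>Passing to a subsequence gives the explicit error
    \<open>1 / real (Suc n)\<close>, which is the correction fed to
    \<open>positive_op_limit\<close>.\<close>
  have "\<exists>k. \<forall>t\<in>real_spectrum A. \<bar>poly (q k) t - f t\<bar> < 1 / real (Suc n)" for n
  proof -
    have "\<forall>\<^sub>F k in sequentially. \<forall>t\<in>real_spectrum A. dist (poly (q k) t) (f t) < 1 / real (Suc n)"
      by (rule uniform_limitD[OF q]) simp
    then obtain M where "\<forall>k\<ge>M. \<forall>t\<in>real_spectrum A. dist (poly (q k) t) (f t) < 1 / real (Suc n)"
      by (auto simp: eventually_sequentially)
    then show ?thesis by (intro exI[of _ M]) (simp add: dist_real_def)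
  qed
  then obtain k where k: "\<And>n t. t \<in> real_spectrum A \<Longrightarrow> \<bar>poly (q (k n)) t - f t\<bar> < 1 / real (Suc n)"
    by metis
  have ul: "uniform_limit (real_spectrum A) (\<lambda>n. poly (q (k n))) f sequentially"
  proof (rule uniform_limitI)
    fix e :: real assume "0 < e"
    then obtain M where M: "1 / real (Suc M) < e" using nat_approx_posE by metis
    have "dist (poly (q (k n)) x) (f x) < e" if "n \<ge> M" "x \<in> real_spectrum A" for n x
    proof -
      have "1 / real (Suc n) \<le> 1 / real (Suc M)" using that by (intro divide_left_mono) auto
      then show ?thesis using k[OF that(2), of n] M by (simp add: dist_real_def)
    qed
    then show "\<forall>\<^sub>F n in sequentially. \<forall>x\<in>real_spectrum A. dist (poly (q (k n)) x) (f x) < e"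
      unfolding eventually_sequentially by blast
  qed
  have lim: "(\<lambda>n. op_poly (q (k n)) A) \<longlonglongrightarrow> cfc f A"
    by (rule cfc_LIMSEQ[OF assms ul])
  have e0: "(\<lambda>n. 1 / real (Suc n)) \<longlonglongrightarrow> 0" by (rule LIMSEQ_Suc[OF lim_1_over_n])
  {
    assume r: "\<And>t. t \<in> real_spectrum A \<Longrightarrow> poly r t \<le> f t"
    show "positive_op (cfc f A - op_poly r A)"
    proof (rule positive_op_limit[OF _ _ e0])
      show "(\<lambda>n. op_poly (q (k n)) A - op_poly r A) \<longlonglongrightarrow> cfc f A - op_poly r A"
        by (intro tendsto_intros lim)
      show "positive_op (op_poly (q (k n)) A - op_poly r A + (1 / real (Suc n)) *\<^sub>R id_blinfun)" for n
      proof -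
        have "positive_op (op_poly (q (k n) - r + [:1 / real (Suc n):]) A)"
        proof (rule op_poly_positive[OF A])
          fix t assume t: "t \<in> real_spectrum A"
          show "0 \<le> poly (q (k n) - r + [:1 / real (Suc n):]) t"
            using k[OF t, of n] r[OF t] unfolding poly_add poly_diff by simp
        qed
        then show ?thesis by (simp only: op_poly_add op_poly_diff op_poly_const)
      qed
    qed
  next
    assume r: "\<And>t. t \<in> real_spectrum A \<Longrightarrow> f t \<le> poly r t"
    show "positive_op (op_poly r A - cfc f A)"
    proof (rule positive_op_limit[OF _ _ e0])
      show "(\<lambda>n. op_poly r A - op_poly (q (k n)) A) \<longlonglongrightarrow> op_poly r A - cfc f A"
        by (intro tendsto_intros lim)
      show "positive_op (op_poly r A - op_poly (q (k n)) A + (1 / real (Suc n)) *\<^sub>R id_blinfun)" for n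
      proof -
        have "positive_op (op_poly (r - q (k n) + [:1 / real (Suc n):]) A)"
        proof (rule op_poly_positive[OF A])
          fix t assume t: "t \<in> real_spectrum A"
          show "0 \<le> poly (r - q (k n) + [:1 / real (Suc n):]) t"
            using k[OF t, of n] r[OF t] unfolding poly_add poly_diff by simp
        qed
        then show ?thesis by (simp only: op_poly_add op_poly_diff op_poly_const)
      qed
    qed
  }
qed

section \<open>Tangent lines of powers\<close>

text \<open>Convexity of \<open>exp\<close> between \<open>0\<close> and \<open>ln y\<close>, with
  weight \<open>s\<close>.\<close>

lemma powr_le_tangent_one:
  fixes s y :: real
  assumes "0 \<le> s" "s \<le> 1" "0 \<le> y"
  shows "y powr s \<le> 1 + s * (y - 1)"
proof (cases "y = 0")
  case False
  then have y: "y > 0" using assms by simp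
  have "exp ((1 - s) *\<^sub>R 0 + s *\<^sub>R ln y) \<le> (1 - s) * exp 0 + s * exp (ln y)"
    using exp_convex assms by (intro convex_onD) auto
  then show ?thesis using y by (simp add: powr_def algebra_simps)
qed (use assms in simp)

text \<open>Bernoulli's inequality, obtained by applying the previous bound with exponent
  \<open>1 / s\<close> to the value \<open>z\<close> of the tangent line. If that value is not
  positive there is nothing to show.\<close>

lemma powr_ge_tangent_one:
  fixes s y :: real
  assumes "1 \<le> s" "0 \<le> y"
  shows "1 + s * (y - 1) \<le> y powr s"
proof (cases "1 + s * (y - 1) \<le> 0")
  case False
  define z where "z = 1 + s * (y - 1)"
  have z: "z > 0" using False by (simp add: z_def)
  have "z powr (1 / s) \<le> 1 + (1 / s) * (z - 1)"
    using assms z by (intro powr_le_tangent_one) auto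
  also have "\<dots> = y" using assms by (simp add: z_def)
  finally have "(z powr (1 / s)) powr s \<le> y powr s"
    using assms by (intro powr_mono2) auto
  then show ?thesis using assms z by (simp add: powr_powr z_def)
qed (use powr_ge_zero[of y s] in linarith)

lemma powr_neg_ge_tangent_one:
  fixes s y :: real
  assumes "s \<le> 0" "0 < y"
  shows "1 + s * (y - 1) \<le> y powr s"
proof -
  have "s * (y - 1) \<le> s * ln y"
    using assms ln_le_minus_one[of y] by (intro mult_left_mono_neg) auto
  also have "1 + s * ln y \<le> exp (s * ln y)" by simp
  finally show ?thesis using assms by (simp add: powr_def)
qed

text \<open>Homogeneity moves the point of tangency from 1 to \<open>c\<close>.\<close>

lemma powr_tangent_rescale:
  fixes s x c :: real
  assumes "0 < c" "0 \<le> x"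
  shows "x powr s = c powr s * (x / c) powr s"
    and "c powr s + s * c powr (s - 1) * (x - c) = c powr s * (1 + s * (x / c - 1))"
proof -
  show "x powr s = c powr s * (x / c) powr s" using assms by (simp add: powr_divide)
  have "c powr (s - 1) * (x - c) = c powr s * (x / c - 1)"
    using assms by (simp add: powr_diff diff_divide_distrib right_diff_distrib)
  then show "c powr s + s * c powr (s - 1) * (x - c) = c powr s * (1 + s * (x / c - 1))"
    by (simp only: mult.assoc distrib_left mult_1_right mult.left_commute[of "c powr s" s])
qed

lemma powr_le_tangent:
  fixes s x c :: real
  assumes "0 \<le> s" "s \<le> 1" "0 < c" "0 \<le> x"
  shows "x powr s \<le> c powr s + s * c powr (s - 1) * (x - c)"
  unfolding powr_tangent_rescale[OF assms(3,4), of s]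
  using assms by (intro mult_left_mono powr_le_tangent_one) auto

lemma powr_ge_tangent:
  fixes s x c :: real
  assumes "1 \<le> s" "0 < c" "0 \<le> x"
  shows "c powr s + s * c powr (s - 1) * (x - c) \<le> x powr s"
  unfolding powr_tangent_rescale[OF assms(2,3), of s]
  using assms by (intro mult_left_mono powr_ge_tangent_one) auto

lemma powr_neg_ge_tangent:
  fixes s x c :: real
  assumes "s \<le> 0" "0 < c" "0 < x"
  shows "c powr s + s * c powr (s - 1) * (x - c) \<le> x powr s"
  unfolding powr_tangent_rescale[OF assms(2) less_imp_le[OF assms(3)], of s]
  using assms by (intro mult_left_mono powr_neg_ge_tangent_one) auto

lemma powr_eq_square_powr_half: "0 \<le> t \<Longrightarrow> t powr p = (t\<^sup>2) powr (p / 2)" for t p :: real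
  using powr_powr[of t 2 "p / 2"] by (cases "t = 0") (auto simp: powr_numeral)

text \<open>With \<open>b = t^2\<close> and \<open>r = p / 2 - 1\<close>, the gap is
  \<open>b * (4 powr r - b powr r)\<close>, so a bound linear in \<open>4 - b\<close> suffices for
  the second factor. The resulting defect vanishes on \<open>[0, 2]\<close> at the end points only,
  and being even its trace is computable.\<close>

lemma powr_chord_defect_gt_2:
  fixes p :: real
  assumes "2 < p"
  shows "\<exists>c>0. \<forall>t\<in>{0..2}. t powr p \<le> 2 powr (p - 2) * t\<^sup>2 - c * (t\<^sup>2 * (4 - t\<^sup>2))"
proof -
  define r where "r = p / 2 - 1"
  have r: "r > 0" using assms by (simp add: r_def)
  have four: "2 powr (p - 2) = 4 powr r"
    using powr_powr[of 2 2 r] by (simp add: r_def powr_numeral right_diff_distrib)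
  have "\<exists>c>0. \<forall>b\<in>{0..4}. b powr r \<le> 4 powr r - c * (4 - b)"
  proof (cases "r \<le> 1")
    case True
    \<comment> \<open>For \<open>r \<le> 1\<close> the power is concave and lies below its tangent
      at 4.\<close>
    show ?thesis
    proof (intro exI[of _ "r * 4 powr (r - 1)"] conjI ballI)
      fix b :: real assume "b \<in> {0..4}"
      then show "b powr r \<le> 4 powr r - r * 4 powr (r - 1) * (4 - b)"
        using powr_le_tangent[of r 4 b] True r by (simp add: algebra_simps)
    qed (use r in simp)
  next
    case False
    \<comment> \<open>For \<open>r > 1\<close> it is convex and lies below the chord from 0 to 4, of
      slope \<open>4 powr (r - 1)\<close>.\<close>
    show ?thesis
    proof (intro exI[of _ "4 powr (r - 1)"] conjI ballI)
      fix b :: real assume b: "b \<in> {0..4}"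
      have "b powr (r - 1) * b \<le> 4 powr (r - 1) * b"
        using b False by (intro mult_right_mono powr_mono2) auto
      moreover have "b powr (r - 1) * b = b powr r"
        using b by (cases "b = 0") (auto simp: powr_diff)
      moreover have "4 powr (r - 1) * 4 = 4 powr r" by (simp add: powr_diff)
      ultimately show "b powr r \<le> 4 powr r - 4 powr (r - 1) * (4 - b)"
        by (simp add: right_diff_distrib)
    qed simp
  qed
  then obtain c where c: "c > 0" "\<And>b. b \<in> {0..4} \<Longrightarrow> b powr r \<le> 4 powr r - c * (4 - b)" by blast
  show ?thesis
  proof (intro exI[of _ c] conjI ballI)
    fix t :: real assume t: "t \<in> {0..2}"
    have b: "t\<^sup>2 \<in> {0..4}" using t power_mono[of t 2 2] by auto
    have "t powr p = t\<^sup>2 * (t\<^sup>2) powr r"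
    proof (cases "t = 0")
      case False
      then have "(t\<^sup>2) powr (1 + r) = t\<^sup>2 * (t\<^sup>2) powr r"
        unfolding powr_add by simp
      then show ?thesis using t by (simp add: powr_eq_square_powr_half[of t p] r_def)
    qed simp
    also have "\<dots> \<le> t\<^sup>2 * (4 powr r - c * (4 - t\<^sup>2))"
      using c(2)[OF b] by (intro mult_left_mono) auto
    finally show "t powr p \<le> 2 powr (p - 2) * t\<^sup>2 - c * (t\<^sup>2 * (4 - t\<^sup>2))"
      by (simp add: four algebra_simps)
  qed (rule c)
qed

text \<open>In the same substitution \<open>r\<close> is negative, so \<open>b powr r\<close> is
  convex and lies above its tangent at 4, whose slope is \<open>- c\<close>. At \<open>t = 0\<close>
  both sides vanish, and that point is treated apart because the tangent bound needs a positive
  argument.\<close>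

lemma powr_chord_defect_lt_2:
  fixes p :: real
  assumes "0 < p" "p < 2"
  shows "\<exists>c>0. \<forall>t\<in>{0..2}. 2 powr (p - 2) * t\<^sup>2 + c * (t\<^sup>2 * (4 - t\<^sup>2)) \<le> t powr p"
proof -
  define r where "r = p / 2 - 1"
  have r: "r < 0" using assms by (simp add: r_def)
  have four: "2 powr (p - 2) = 4 powr r"
    using powr_powr[of 2 2 r] by (simp add: r_def powr_numeral right_diff_distrib)
  define c where "c = - r * 4 powr (r - 1)"
  have "c > 0" using r by (simp add: c_def mult_neg_pos)
  moreover have "2 powr (p - 2) * t\<^sup>2 + c * (t\<^sup>2 * (4 - t\<^sup>2)) \<le> t powr p" if t: "t \<in> {0..2}" for t :: real
  proof (cases "t = 0")
    case False
    have "t powr p = (t\<^sup>2) powr (1 + r)"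
      using t by (simp add: powr_eq_square_powr_half[of t p] r_def)
    also have "\<dots> = t\<^sup>2 * (t\<^sup>2) powr r" using False unfolding powr_add by simp
    also have "\<dots> \<ge> t\<^sup>2 * (4 powr r + r * 4 powr (r - 1) * (t\<^sup>2 - 4))"
      using r False by (intro mult_left_mono powr_neg_ge_tangent) auto
    finally show ?thesis by (simp add: four c_def algebra_simps)
  qed simp
  ultimately show ?thesis by blast
qed

section \<open>Absolute values\<close>

lemma continuous_on_powr_const: "0 < p \<Longrightarrow> continuous_on {0..b} (\<lambda>t::real. t powr p)"
  by (intro continuous_on_powr') (auto intro!: continuous_intros)

text \<open>If \<open>poly q t\<close> were nonzero, write \<open>q - poly q t\<close> as the
  product of the linear factor at \<open>t\<close> and some \<open>s\<close>; then
  \<open>k *\<^sub>R op_poly s A\<close> inverts \<open>A - t\<close>.\<close>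

lemma real_spectrum_root:
  assumes "op_poly q A = 0" and t: "t \<in> real_spectrum A" and A: "selfadjoint A"
  shows "poly q t = 0"
proof (rule ccontr)
  assume nz: "poly q t \<noteq> 0"
  define k where "k = - 1 / poly q t"
  have "poly (q - [:poly q t:]) t = 0" by simp
  then obtain s where s: "q - [:poly q t:] = [:-t, 1:] * s" by (metis dvdE poly_eq_0_iff_dvd)
  define T where "T = A - t *\<^sub>R id_blinfun"
  have T: "T = op_poly [:-t, 1:] A" by (simp add: T_def op_poly_pCons)
  have "op_poly (q - [:poly q t:]) A = - (poly q t *\<^sub>R id_blinfun)"
    using assms(1) by (simp add: op_poly_diff op_poly_const)
  then have prod: "T o\<^sub>L op_poly s A = - (poly q t *\<^sub>R id_blinfun)"
      "op_poly s A o\<^sub>L T = - (poly q t *\<^sub>R id_blinfun)"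
    unfolding s T op_poly_mult[symmetric] by (simp_all only: mult.commute)
  have "(k *\<^sub>R op_poly s A) o\<^sub>L T = id_blinfun" "T o\<^sub>L (k *\<^sub>R op_poly s A) = id_blinfun"
    unfolding compose_simps prod using nz by (simp_all add: k_def)
  moreover have "k *\<^sub>R op_poly s A \<in> bounded_ops"
    using selfadjoint_op_poly[OF A] by (intro bounded_ops_scaleR selfadjointD)
  ultimately have "invertible_op T" unfolding invertible_op_def by blast
  then show False using t by (simp add: T_def real_spectrum_def op_spectrum_iff scaleR_eq_op_scale)
qed

text \<open>Polynomials converging to \<open>sqrt\<close> on the spectrum of \<open>B\<close> have
  squares converging to the identity function, which gives the square of \<open>abs_op A\<close>.
  Hence \<open>abs_op A x\<close> and \<open>A x\<close> have equal norms; the norm bound later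
  confines the spectrum to \<open>[0, 2]\<close> for sums and differences of unitaries.\<close>

lemma
  assumes A: "A \<in> bounded_ops"
  shows positive_op_abs_op: "positive_op (abs_op A)"
    and abs_op_square: "abs_op A o\<^sub>L abs_op A = adjoint_op A o\<^sub>L A"
    and norm_abs_op_le: "norm (abs_op A) \<le> norm A"
proof -
  define B where "B = adjoint_op A o\<^sub>L A"
  have B: "selfadjoint B" "positive_op B"
    unfolding B_def using A by (auto intro: selfadjoint_adjoint_compose positive_op_adjoint_compose)
  have spec: "real_spectrum B \<subseteq> {0..norm B}" using B by (intro real_spectrum_positive_op)
  have cont: "continuous_on {0..norm B} sqrt" by (intro continuous_intros)
  have C: "abs_op A = cfc sqrt B" by (simp add: abs_op_def B_def)
  obtain q where q: "uniform_limit (real_spectrum B) (\<lambda>n. poly (q n)) sqrt sequentially"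
      "(\<lambda>n. op_poly (q n) B) \<longlonglongrightarrow> abs_op A"
    unfolding C using cfc_approximation[OF B(1) spec cont] by blast
  have "positive_op (cfc sqrt B - op_poly 0 B)"
    using spec by (intro cfc_minus_op_poly_positive[OF B(1) spec cont]) auto
  then show pos: "positive_op (abs_op A)" by (simp add: C)
  \<comment> \<open>Products of uniform limits converge uniformly only when the limit functions are
    bounded.\<close>
  have "bounded (sqrt ` real_spectrum B)"
    using compact_imp_bounded[OF compact_continuous_image[OF cont]] spec
    by (meson bounded_subset compact_Icc image_mono)
  then have "uniform_limit (real_spectrum B) (\<lambda>n t. poly (q n) t * poly (q n) t)
      (\<lambda>t. sqrt t * sqrt t) sequentially"
    by (intro uniform_lim_mult q)
  then have "uniform_limit (real_spectrum B) (\<lambda>n. poly (q n * q n)) (\<lambda>t. sqrt t * sqrt t) sequentially"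
    by (simp add: poly_mult[abs_def])
  then have "(\<lambda>n. op_poly (q n * q n) B) \<longlonglongrightarrow> cfc (\<lambda>t. sqrt t * sqrt t) B"
    by (rule cfc_LIMSEQ[OF B(1) spec, rotated]) (intro continuous_intros)
  moreover have "cfc (\<lambda>t. sqrt t * sqrt t) B = op_poly [:0, 1:] B"
    using spec by (intro cfc_eq_op_poly[OF B(1) spec]) (auto intro!: continuous_intros)
  ultimately have "(\<lambda>n. op_poly (q n * q n) B) \<longlonglongrightarrow> B" by (simp add: op_poly_pCons)
  moreover have "(\<lambda>n. op_poly (q n) B o\<^sub>L op_poly (q n) B) \<longlonglongrightarrow> (abs_op A o\<^sub>L abs_op A)"
    by (intro bounded_bilinear.tendsto[OF bounded_bilinear_blinfun_compose] q)
  ultimately show sq: "abs_op A o\<^sub>L abs_op A = adjoint_op A o\<^sub>L A"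
    unfolding op_poly_mult B_def[symmetric] by (rule LIMSEQ_unique[rotated])
  show "norm (abs_op A) \<le> norm A"
  proof (rule norm_blinfun_bound)
    fix x
    have "cinner (abs_op A x) (abs_op A x) = cinner ((abs_op A o\<^sub>L abs_op A) x) x"
      using selfadjointD(3)[OF positive_imp_selfadjoint[OF pos], of "abs_op A x" x] by simp
    also have "\<dots> = cinner (A x) (A x)"
      unfolding sq using cinner_adjoint_left[OF A] by simp
    finally have "complex_of_real ((norm (abs_op A x))\<^sup>2) = complex_of_real ((norm (A x))\<^sup>2)"
      by (simp only: cinner_self)
    then have "norm (abs_op A x) = norm (A x)" by (simp only: of_real_eq_iff) simp
    then show "norm (abs_op A x) \<le> norm A * norm x" by (simp add: norm_blinfun)
  qed simp
qed

lemma real_spectrum_abs_op: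
  assumes "A \<in> bounded_ops"
  shows "real_spectrum (abs_op A) \<subseteq> {0..norm A}"
proof -
  have "{0..norm (abs_op A)} \<subseteq> {0..norm A}" using norm_abs_op_le[OF assms] by simp
  then show ?thesis using real_spectrum_positive_op[OF positive_op_abs_op[OF assms]] by blast
qed

lemma selfadjoint_abs_op: "A \<in> bounded_ops \<Longrightarrow> selfadjoint (abs_op A)"
  by (intro positive_imp_selfadjoint positive_op_abs_op)

section \<open>Traces on von Neumann algebras\<close>

locale tracial_algebra =
  fixes N :: "'h::complex_hilbert oper set" and \<tau> :: "'h oper \<Rightarrow> complex"
  assumes von_neumann: "von_neumann_algebra N"
    and trace: "tracial_state N \<tau>"
    and faithful: "faithful_state N \<tau>"
begin

lemma N_bounded: "A \<in> N \<Longrightarrow> A \<in> bounded_ops"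
  using von_neumann by (auto simp: von_neumann_algebra_def)

lemma N_adjoint: "A \<in> N \<Longrightarrow> adjoint_op A \<in> N"
  using von_neumann by (auto simp: von_neumann_algebra_def)

text \<open>The double commutant condition as a membership test: closure properties reduce to
  commutation identities.\<close>

lemma N_iff: "A \<in> N \<longleftrightarrow> A \<in> bounded_ops \<and> (\<forall>B\<in>commutant N. B o\<^sub>L A = A o\<^sub>L B)"
proof -
  have "N = commutant (commutant N)" using von_neumann by (simp add: von_neumann_algebra_def)
  then have "A \<in> N \<longleftrightarrow> A \<in> commutant (commutant N)" by simp
  then show ?thesis by (simp add: commutant_def[of "commutant N"])
qed

lemma commutant_bounded: "B \<in> commutant N \<Longrightarrow> B \<in> bounded_ops"
  by (simp add: commutant_def)

lemma N_id: "id_blinfun \<in> N"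
  by (simp add: N_iff bounded_ops_id)

lemma N_add: "A \<in> N \<Longrightarrow> B \<in> N \<Longrightarrow> A + B \<in> N"
  by (simp add: N_iff bounded_ops_add compose_simps)

lemma N_diff: "A \<in> N \<Longrightarrow> B \<in> N \<Longrightarrow> A - B \<in> N"
  by (simp add: N_iff bounded_ops_diff compose_simps)

lemma N_op_scale: "A \<in> N \<Longrightarrow> op_scale c A \<in> N"
  by (simp add: N_iff bounded_ops_op_scale compose_op_scale_left compose_op_scale_right
      commutant_bounded)

lemma N_scaleR: "A \<in> N \<Longrightarrow> r *\<^sub>R A \<in> N"
  by (simp add: scaleR_eq_op_scale N_op_scale)

lemma N_compose: "A \<in> N \<Longrightarrow> B \<in> N \<Longrightarrow> A o\<^sub>L B \<in> N"
proof -
  assume A: "A \<in> N" and B: "B \<in> N"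
  have "C o\<^sub>L (A o\<^sub>L B) = (A o\<^sub>L B) o\<^sub>L C" if "C \<in> commutant N" for C
  proof -
    have "C o\<^sub>L (A o\<^sub>L B) = (C o\<^sub>L A) o\<^sub>L B" by (simp only: compose_assoc)
    also have "\<dots> = A o\<^sub>L (C o\<^sub>L B)" using A that by (simp add: N_iff compose_assoc)
    also have "\<dots> = (A o\<^sub>L B) o\<^sub>L C" using B that by (simp add: N_iff compose_assoc)
    finally show ?thesis .
  qed
  then show "A o\<^sub>L B \<in> N" using A B N_bounded by (auto simp: N_iff bounded_ops_compose)
qed

lemmas N_intros = N_id N_add N_diff N_op_scale N_scaleR N_compose N_adjoint

lemma N_op_poly: "A \<in> N \<Longrightarrow> op_poly q A \<in> N"
proof (induction q)
  case 0
  then show ?case using N_scaleR[of A 0] by simp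
qed (simp add: op_poly_pCons N_intros)

lemma closed_N: "closed N"
proof (rule closed_sequential_limits[THEN iffD2], intro allI impI, elim conjE)
  fix A L assume A: "\<forall>n::nat. A n \<in> N" and lim: "A \<longlonglongrightarrow> L"
  have "L \<in> bounded_ops"
    using A N_bounded by (intro closed_sequentially[OF closed_bounded_ops _ lim]) auto
  moreover have "B o\<^sub>L L = L o\<^sub>L B" if B: "B \<in> commutant N" for B
  proof (rule LIMSEQ_unique)
    show "(\<lambda>n. B o\<^sub>L A n) \<longlonglongrightarrow> (B o\<^sub>L L)"
      by (intro bounded_bilinear.tendsto[OF bounded_bilinear_blinfun_compose] lim tendsto_const)
    have "(\<lambda>n. A n o\<^sub>L B) \<longlonglongrightarrow> (L o\<^sub>L B)"
      by (intro bounded_bilinear.tendsto[OF bounded_bilinear_blinfun_compose] lim tendsto_const)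
    moreover have "A n o\<^sub>L B = B o\<^sub>L A n" for n using A B by (simp add: N_iff)
    ultimately show "(\<lambda>n. B o\<^sub>L A n) \<longlonglongrightarrow> (L o\<^sub>L B)" by simp
  qed
  ultimately show "L \<in> N" by (simp add: N_iff)
qed

lemma N_cfc:
  assumes "A \<in> N" "selfadjoint A" "real_spectrum A \<subseteq> {a..b}" "continuous_on {a..b} f"
  shows "cfc f A \<in> N"
proof -
  obtain q where "(\<lambda>n. op_poly (q n) A) \<longlonglongrightarrow> cfc f A"
    using cfc_approximation[OF assms(2-4)] by blast
  from closed_sequentially[OF closed_N _ this] show ?thesis
    using N_op_poly[OF assms(1)] by blast
qed

lemma N_abs_op:
  assumes "A \<in> N"
  shows "abs_op A \<in> N"
  unfolding abs_op_def
proof (rule N_cfc)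
  have A: "A \<in> bounded_ops" using assms by (rule N_bounded)
  show "adjoint_op A o\<^sub>L A \<in> N" using assms by (intro N_intros)
  show "selfadjoint (adjoint_op A o\<^sub>L A)" using A by (rule selfadjoint_adjoint_compose)
  show "real_spectrum (adjoint_op A o\<^sub>L A) \<subseteq> {0..norm (adjoint_op A o\<^sub>L A)}"
    using A by (intro real_spectrum_positive_op positive_op_adjoint_compose)
qed (intro continuous_intros)

section \<open>Rules for the trace\<close>

lemma trace_add: "A \<in> N \<Longrightarrow> B \<in> N \<Longrightarrow> \<tau> (A + B) = \<tau> A + \<tau> B"
  using trace by (simp add: tracial_state_def)

lemma trace_op_scale: "A \<in> N \<Longrightarrow> \<tau> (op_scale c A) = c * \<tau> A"
  using trace by (simp add: tracial_state_def)

lemma trace_scaleR: "A \<in> N \<Longrightarrow> \<tau> (r *\<^sub>R A) = of_real r * \<tau> A"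
  by (simp add: scaleR_eq_op_scale trace_op_scale)

lemma trace_diff: "A \<in> N \<Longrightarrow> B \<in> N \<Longrightarrow> \<tau> (A - B) = \<tau> A - \<tau> B"
  using trace_add[of A "(- 1) *\<^sub>R B"] trace_scaleR[of B "-1"] N_scaleR[of B "-1"] by simp

lemma trace_id: "\<tau> id_blinfun = 1"
  using trace by (simp add: tracial_state_def)

lemma trace_commute: "A \<in> N \<Longrightarrow> B \<in> N \<Longrightarrow> \<tau> (A o\<^sub>L B) = \<tau> (B o\<^sub>L A)"
  using trace by (simp add: tracial_state_def)

lemma trace_positive:
  assumes "A \<in> N" "positive_op A"
  shows "\<tau> A \<in> \<real>" "0 \<le> Re (\<tau> A)"
  using trace assms unfolding tracial_state_def by blast+

lemma trace_mono:
  assumes "A \<in> N" "B \<in> N" "positive_op (B - A)"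
  shows "Re (\<tau> A) \<le> Re (\<tau> B)"
  using trace_positive(2)[OF N_diff[OF assms(2,1)] assms(3)] trace_diff[OF assms(2,1)] by simp

text \<open>Positivity makes the trace real and nonnegative, so the bound forces it to be 0 and
  faithfulness applies. Equality of operators is obtained below by showing this for their
  difference.\<close>

lemma trace_adjoint_compose_zero:
  assumes A: "A \<in> N" and "Re (\<tau> (adjoint_op A o\<^sub>L A)) \<le> 0"
  shows "A = 0"
proof -
  let ?B = "adjoint_op A o\<^sub>L A"
  have B: "?B \<in> N" "positive_op ?B"
    using A N_bounded by (auto intro: N_intros positive_op_adjoint_compose)
  then have "\<tau> ?B \<in> \<real>" "0 \<le> Re (\<tau> ?B)" by (auto intro: trace_positive)
  then have "\<tau> ?B = 0" using assms(2) by (simp add: complex_eq_iff complex_is_Real_iff)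
  then have z: "?B = 0" using faithful B by (auto simp: faithful_state_def)
  have "cinner (A x) (A x) = 0" for x
    using cinner_adjoint_left[OF N_bounded[OF A], of "A x" x] z
    by (metis blinfun_apply_blinfun_compose blinfun.zero_left cinner_diff_left diff_self)
  then show ?thesis by (intro blinfun_eqI) (simp add: cinner_self)
qed

text \<open>This is the \<open>p\<close>-th power of the \<open>p\<close>-norm. The sums of
  distances that matter are sums of these powers, and the outer root would break linearity of the
  trace.\<close>

definition Lp_integral :: "real \<Rightarrow> 'h oper \<Rightarrow> real" where
  "Lp_integral p A = Re (\<tau> (cfc (\<lambda>t. t powr p) (abs_op A)))"

lemma N_powr_abs_op:
  assumes "A \<in> N" "0 < p"
  shows "cfc (\<lambda>t. t powr p) (abs_op A) \<in> N"
  by (rule N_cfc[OF N_abs_op[OF assms(1)] selfadjoint_abs_op[OF N_bounded[OF assms(1)]]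
        real_spectrum_abs_op[OF N_bounded[OF assms(1)]] continuous_on_powr_const[OF assms(2)]])

text \<open>A scalar inequality on \<open>[0, norm A]\<close> becomes an operator inequality by
  functional calculus, and the trace is monotone. This stands in for integration against a spectral
  measure.\<close>

lemma Lp_integral_le:
  assumes A: "A \<in> N" and p: "0 < p" and r: "\<And>t. t \<in> {0..norm A} \<Longrightarrow> t powr p \<le> poly r t"
  shows "Lp_integral p A \<le> Re (\<tau> (op_poly r (abs_op A)))"
  unfolding Lp_integral_def
proof (rule trace_mono[OF N_powr_abs_op[OF A p] N_op_poly[OF N_abs_op[OF A]]])
  have spec: "real_spectrum (abs_op A) \<subseteq> {0..norm A}"
    by (rule real_spectrum_abs_op[OF N_bounded[OF A]])
  show "positive_op (op_poly r (abs_op A) - cfc (\<lambda>t. t powr p) (abs_op A))"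
    by (rule op_poly_minus_cfc_positive[OF selfadjoint_abs_op[OF N_bounded[OF A]] spec
          continuous_on_powr_const[OF p]]) (use spec r in blast)
qed

lemma Lp_integral_ge:
  assumes A: "A \<in> N" and p: "0 < p" and r: "\<And>t. t \<in> {0..norm A} \<Longrightarrow> poly r t \<le> t powr p"
  shows "Re (\<tau> (op_poly r (abs_op A))) \<le> Lp_integral p A"
  unfolding Lp_integral_def
proof (rule trace_mono[OF N_op_poly[OF N_abs_op[OF A]] N_powr_abs_op[OF A p]])
  have spec: "real_spectrum (abs_op A) \<subseteq> {0..norm A}"
    by (rule real_spectrum_abs_op[OF N_bounded[OF A]])
  show "positive_op (cfc (\<lambda>t. t powr p) (abs_op A) - op_poly r (abs_op A))"
    by (rule cfc_minus_op_poly_positive[OF selfadjoint_abs_op[OF N_bounded[OF A]] spec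
          continuous_on_powr_const[OF p]]) (use spec r in blast)
qed

lemma Lp_integral_nonneg:
  assumes "A \<in> N" "0 < p"
  shows "0 \<le> Lp_integral p A"
  using Lp_integral_ge[OF assms, of 0] trace_scaleR[OF N_id, of 0] by simp

lemma Lp_norm_eq_iff:
  assumes "A \<in> N" "B \<in> N" "0 < p"
  shows "Lp_norm \<tau> p A = Lp_norm \<tau> p B \<longleftrightarrow> Lp_integral p A = Lp_integral p B"
proof -
  have "(Lp_norm \<tau> p C) powr p = Lp_integral p C" if "C \<in> N" for C
    using Lp_integral_nonneg[OF that assms(3)] assms(3)
    by (simp add: Lp_norm_def Lp_integral_def powr_powr)
  then show ?thesis using assms by (metis Lp_norm_def Lp_integral_def)
qed

lemma Lp_integral_scalar:
  assumes A: "A \<in> N" and p: "0 < p" and b: "0 \<le> b" and sq: "adjoint_op A o\<^sub>L A = b *\<^sub>R id_blinfun"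
  shows "Lp_integral p A = b powr (p / 2)"
proof -
  have spec: "real_spectrum (s *\<^sub>R id_blinfun :: 'h oper) \<subseteq> {s}" for s
  proof
    fix t assume t: "t \<in> real_spectrum (s *\<^sub>R id_blinfun :: 'h oper)"
    have "op_poly [:-s, 1:] (s *\<^sub>R id_blinfun :: 'h oper) = 0" by (simp add: op_poly_pCons)
    from real_spectrum_root[OF this t] show "t \<in> {s}"
      by (simp add: selfadjoint_scaleR selfadjoint_id)
  qed
  have cfc_scalar: "cfc f (s *\<^sub>R id_blinfun :: 'h oper) = f s *\<^sub>R id_blinfun" for f s
    using cfc_eq_op_poly[of "s *\<^sub>R id_blinfun :: 'h oper" s s f "[:f s:]"] spec[of s]
    by (fastforce simp: op_poly_const selfadjoint_scaleR selfadjoint_id)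
  have "Lp_integral p A = sqrt b powr p"
    unfolding Lp_integral_def abs_op_def sq cfc_scalar by (simp add: trace_scaleR N_id trace_id)
  then show ?thesis using b powr_eq_square_powr_half[of "sqrt b" p] by simp
qed

text \<open>The spectrum of \<open>B\<close> lies in \<open>{0, 4}\<close>, where the root is
  \<open>t / 2\<close>; that of \<open>abs_op A\<close> lies in \<open>{0, 2}\<close>, where
  \<open>t powr p\<close> is \<open>2 powr (p - 1) * t\<close>. Both functions are thus linear, and
  the factors combine to \<open>2 powr (p - 2)\<close>.\<close>

lemma Lp_integral_two_valued:
  assumes A: "A \<in> N" and p: "0 < p" and B: "B = adjoint_op A o\<^sub>L A" and sq: "B o\<^sub>L B = 4 *\<^sub>R B"
  shows "Lp_integral p A = 2 powr (p - 2) * Re (\<tau> B)"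
proof -
  have Ab: "A \<in> bounded_ops" using A by (rule N_bounded)
  have BN: "B \<in> N" unfolding B using A by (intro N_intros)
  have sB: "selfadjoint B" unfolding B using Ab by (rule selfadjoint_adjoint_compose)
  have specB: "real_spectrum B \<subseteq> {0, 4}"
  proof
    fix t assume t: "t \<in> real_spectrum B"
    have "op_poly [:0, -4, 1:] B = 0" by (simp add: op_poly_pCons compose_simps sq)
    from real_spectrum_root[OF this t sB] show "t \<in> {0, 4}" by auto
  qed
  have "cfc sqrt B = op_poly [:0, 1/2:] B"
    using specB by (intro cfc_eq_op_poly[OF sB, of 0 4]) (auto intro!: continuous_intros)
  then have abs: "abs_op A = (1/2) *\<^sub>R B" by (simp add: abs_op_def B op_poly_pCons compose_simps)
  define C where "C = (1/2) *\<^sub>R B"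
  have sC: "selfadjoint C" unfolding C_def using sB by (rule selfadjoint_scaleR)
  have specC: "real_spectrum C \<subseteq> {0, 2}"
  proof
    fix t assume t: "t \<in> real_spectrum C"
    have "op_poly [:0, -2, 1:] C = 0" by (simp add: C_def op_poly_pCons compose_simps sq)
    from real_spectrum_root[OF this t sC] show "t \<in> {0, 2}" by auto
  qed
  have "cfc (\<lambda>t. t powr p) C = op_poly [:0, 2 powr (p - 1):] C"
    using specC p by (intro cfc_eq_op_poly[OF sC, of 0 2] continuous_on_powr_const)
      (auto simp: powr_diff)
  then show ?thesis
    using BN unfolding Lp_integral_def abs C_def[symmetric]
    by (simp add: C_def op_poly_pCons compose_simps trace_scaleR powr_diff)
qed

section \<open>Jensen's inequality for the trace\<close>

lemma op_poly_square_abs_op: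
  assumes "A \<in> N"
  shows "op_poly [:a, 0, b:] (abs_op A) = a *\<^sub>R id_blinfun + b *\<^sub>R (adjoint_op A o\<^sub>L A)"
    and "op_poly [:0, 0, b, 0, c:] (abs_op A) = b *\<^sub>R (adjoint_op A o\<^sub>L A)
      + c *\<^sub>R ((adjoint_op A o\<^sub>L A) o\<^sub>L (adjoint_op A o\<^sub>L A))"
proof -
  have sq: "abs_op A o\<^sub>L abs_op A = adjoint_op A o\<^sub>L A"
    using assms by (intro abs_op_square N_bounded)
  then show "op_poly [:a, 0, b:] (abs_op A) = a *\<^sub>R id_blinfun + b *\<^sub>R (adjoint_op A o\<^sub>L A)"
    by (simp add: op_poly_pCons compose_simps)
  show "op_poly [:0, 0, b, 0, c:] (abs_op A) = b *\<^sub>R (adjoint_op A o\<^sub>L A)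
      + c *\<^sub>R ((adjoint_op A o\<^sub>L A) o\<^sub>L (adjoint_op A o\<^sub>L A))"
    unfolding sq[symmetric] by (simp add: op_poly_pCons compose_simps compose_assoc)
qed

text \<open>Here \<open>r\<close> is the tangent line of the power \<open>p / 2\<close> at
  \<open>b\<close>, written in \<open>t^2\<close>, with slope \<open>k\<close>. It lies below the
  power for \<open>2 \<le> p\<close> and above it for \<open>p \<le> 2\<close>; taking traces, the
  constant terms cancel against \<open>eq\<close>, and dividing by \<open>k > 0\<close> leaves the
  bound.\<close>

lemma trace_square_bound:
  assumes A: "A \<in> N" and p: "0 < p" and b: "0 < b" and eq: "Lp_integral p A = b powr (p / 2)"
  shows "2 \<le> p \<Longrightarrow> Re (\<tau> (adjoint_op A o\<^sub>L A)) \<le> b"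
    and "p \<le> 2 \<Longrightarrow> b \<le> Re (\<tau> (adjoint_op A o\<^sub>L A))"
proof -
  define q where "q = p / 2"
  define k where "k = q * b powr (q - 1)"
  have k: "k > 0" using p b by (simp add: k_def q_def)
  define r where "r = [:b powr q - k * b, 0, k:]"
  have poly_r: "poly r t = b powr q + k * (t\<^sup>2 - b)" for t
    by (simp add: r_def power2_eq_square algebra_simps)
  have N2: "adjoint_op A o\<^sub>L A \<in> N" using A by (intro N_intros)
  have trace_r: "Re (\<tau> (op_poly r (abs_op A))) = b powr q + k * (Re (\<tau> (adjoint_op A o\<^sub>L A)) - b)"
    unfolding r_def op_poly_square_abs_op[OF A]
    using N2 by (simp add: trace_add trace_scaleR N_id N_scaleR trace_id) (simp add: algebra_simps)
  {
    assume "2 \<le> p"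
    then have "poly r t \<le> t powr p" if "t \<in> {0..norm A}" for t
      using that b powr_ge_tangent[of q b "t\<^sup>2"]
      by (simp add: poly_r powr_eq_square_powr_half[of t p] k_def q_def)
    from Lp_integral_ge[OF A p this] show "Re (\<tau> (adjoint_op A o\<^sub>L A)) \<le> b"
      using k by (simp add: trace_r eq q_def mult_le_0_iff)
  next
    assume "p \<le> 2"
    then have "t powr p \<le> poly r t" if "t \<in> {0..norm A}" for t
      using that b p powr_le_tangent[of q b "t\<^sup>2"]
      by (simp add: poly_r powr_eq_square_powr_half[of t p] k_def q_def)
    from Lp_integral_le[OF A p this] show "b \<le> Re (\<tau> (adjoint_op A o\<^sub>L A))"
      using k by (simp add: trace_r eq q_def zero_le_mult_iff)
  }
qed

section \<open>Distances between unitaries\<close>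

lemma unitaryD:
  assumes "U \<in> unitary_group N"
  shows "U \<in> N" "U \<in> bounded_ops" "adjoint_op U o\<^sub>L U = id_blinfun" "U o\<^sub>L adjoint_op U = id_blinfun"
  using assms N_bounded by (auto simp: unitary_group_def)

lemma unitary_id: "id_blinfun \<in> unitary_group N"
  by (simp add: unitary_group_def N_id adjoint_op_id)

lemma unitary_op_scale:
  assumes U: "U \<in> unitary_group N" and c: "cmod c = 1"
  shows "op_scale c U \<in> unitary_group N"
proof -
  have "c * cnj c = 1" using c complex_norm_square[of c] by simp
  then show ?thesis
    using unitaryD[OF U]
    by (simp add: unitary_group_def N_op_scale adjoint_op_scale compose_op_scale_left
        compose_op_scale_right adjoint_op_bounded op_scale_op_scale op_scale_one mult.commute)
qed

lemma norm_unitary_le: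
  assumes U: "U \<in> unitary_group N"
  shows "norm U \<le> 1"
proof (rule norm_blinfun_bound)
  fix x
  have "adjoint_op U (U x) = x"
    by (metis unitaryD(3)[OF U] blinfun_apply_blinfun_compose blinfun_apply_id_blinfun)
  then have "complex_of_real ((norm (U x))\<^sup>2) = complex_of_real ((norm x)\<^sup>2)"
    using cinner_adjoint_left[OF unitaryD(2)[OF U], of "U x" x] by (simp only: cinner_self)
  then have "norm (U x) = norm x" by (simp only: of_real_eq_iff) simp
  then show "norm (U x) \<le> 1 * norm x" by simp
qed simp

text \<open>The mixed term of the squared modulus of \<open>V - W\<close> or \<open>V + W\<close>,
  up to sign. It is self-adjoint for \<open>V\<close> and \<open>W\<close> in
  \<open>N\<close>.\<close>

definition cross_op :: "'h oper \<Rightarrow> 'h oper \<Rightarrow> 'h oper" where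
  "cross_op V W = (adjoint_op V o\<^sub>L W) + (adjoint_op W o\<^sub>L V)"

lemma N_cross_op: "V \<in> N \<Longrightarrow> W \<in> N \<Longrightarrow> cross_op V W \<in> N"
  unfolding cross_op_def by (intro N_intros)

lemma
  assumes V: "V \<in> unitary_group N" and W: "W \<in> unitary_group N"
  shows unitary_diff_square: "adjoint_op (V - W) o\<^sub>L (V - W) = 2 *\<^sub>R id_blinfun - cross_op V W"
    and unitary_add_square: "adjoint_op (V + W) o\<^sub>L (V + W) = 2 *\<^sub>R id_blinfun + cross_op V W"
  using unitaryD[OF V] unitaryD[OF W]
  by (simp_all add: adjoint_op_diff adjoint_op_add compose_simps cross_op_def scaleR_2)

lemma
  assumes V: "V \<in> unitary_group N" and W: "W \<in> unitary_group N"
  shows norm_unitary_diff_le: "norm (V - W) \<le> 2" and norm_unitary_add_le: "norm (V + W) \<le> 2"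
  using norm_triangle_ineq4[of V W] norm_triangle_ineq[of V W] norm_unitary_le[OF V]
    norm_unitary_le[OF W] by linarith+

lemma cross_op_scale:
  assumes "V \<in> bounded_ops" "W \<in> bounded_ops"
  shows "cross_op (op_scale a V) (op_scale b W)
    = op_scale (cnj a * b) (adjoint_op V o\<^sub>L W) + op_scale (cnj b * a) (adjoint_op W o\<^sub>L V)"
  using assms by (simp add: cross_op_def adjoint_op_scale compose_op_scale_left
      compose_op_scale_right adjoint_op_bounded op_scale_op_scale)

text \<open>On \<open>[0, 2]\<close> the function \<open>t\<^sup>p\<close> lies strictly on one side of its quadratic chord
  \<open>2\<^sup>p\<^sup>-\<^sup>2 t\<^sup>2\<close> except at the end points, so this extremal sum of distances forces \<open>|V - \<lambda>|\<close> to
  have spectrum in \<open>{0, 2}\<close>.\<close>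

lemma antipodal_distances_imp_selfadjoint:
  assumes V: "V \<in> unitary_group N" and l: "cmod l = 1" and p: "0 < p" "p \<noteq> 2"
    and eq: "Lp_integral p (V - op_scale l id_blinfun) + Lp_integral p (V + op_scale l id_blinfun)
      = 2 powr p"
  shows "adjoint_op (op_scale (cnj l) V) = op_scale (cnj l) V"
proof -
  define W where "W = op_scale l (id_blinfun :: 'h oper)"
  have W: "W \<in> unitary_group N" unfolding W_def using unitary_id l by (rule unitary_op_scale)
  define Z where "Z = op_scale (cnj l) V"
  have Z: "Z \<in> unitary_group N" unfolding Z_def using V l by (intro unitary_op_scale) auto
  note ZD = unitaryD[OF Z]
  define X where "X = cross_op V W"
  have X_Z: "X = Z + adjoint_op Z"
    using unitaryD[OF V] by (simp add: X_def cross_op_def W_def Z_def adjoint_op_scale adjoint_op_id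
        bounded_ops_id compose_op_scale_left compose_op_scale_right adjoint_op_bounded add.commute)
  have XN: "X \<in> N" unfolding X_Z using ZD by (intro N_intros)
  \<comment> \<open>The squared moduli of \<open>V - W\<close> and \<open>V + W\<close> are
    \<open>2 - X\<close> and \<open>2 + X\<close>, so the scalar defect
    \<open>t^2 * (4 - t^2)\<close> becomes \<open>(2 - X) (2 + X) = D\<close> in both cases.\<close>
  define D where "D = 4 *\<^sub>R id_blinfun - (X o\<^sub>L X)"
  have DN: "D \<in> N" unfolding D_def using XN by (intro N_intros)
  define a where "a = 2 powr (p - 2)"
  have a: "4 * a = 2 powr p" by (simp add: a_def powr_diff)
  have NVW: "V - W \<in> N" "V + W \<in> N" using unitaryD[OF V] unitaryD[OF W] by (auto intro: N_intros)
  have as_poly: "2 *\<^sub>R id_blinfun - X = op_poly [:2, - 1:] X"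
      "2 *\<^sub>R id_blinfun + X = op_poly [:2, 1:] X" "D = op_poly [:4, 0, - 1:] X"
    by (simp_all add: D_def op_poly_pCons compose_simps)
  \<comment> \<open>The polynomial is \<open>a * t^2 - c * (t^2 * (4 - t^2))\<close>. The sign of
    \<open>c\<close> is left free because it is used with \<open>- c\<close> when
    \<open>p < 2\<close>.\<close>
  have trace_minus: "Re (\<tau> (op_poly [:0, 0, a - 4 * c, 0, c:] (abs_op (V - W))))
      = a * Re (\<tau> (2 *\<^sub>R id_blinfun - X)) - c * Re (\<tau> D)" for c
  proof -
    have "op_poly [:0, 0, a - 4 * c, 0, c:] (abs_op (V - W))
        = a *\<^sub>R (2 *\<^sub>R id_blinfun - X) - c *\<^sub>R D"
      unfolding op_poly_square_abs_op[OF NVW(1)] unitary_diff_square[OF V W] X_def[symmetric] as_poly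
        op_poly_mult[symmetric] op_poly_smult[symmetric] op_poly_add[symmetric] op_poly_diff[symmetric]
      by (simp add: algebra_simps)
    then show ?thesis using XN DN by (simp add: trace_diff trace_scaleR N_intros)
  qed
  have trace_plus: "Re (\<tau> (op_poly [:0, 0, a - 4 * c, 0, c:] (abs_op (V + W))))
      = a * Re (\<tau> (2 *\<^sub>R id_blinfun + X)) - c * Re (\<tau> D)" for c
  proof -
    have "op_poly [:0, 0, a - 4 * c, 0, c:] (abs_op (V + W))
        = a *\<^sub>R (2 *\<^sub>R id_blinfun + X) - c *\<^sub>R D"
      unfolding op_poly_square_abs_op[OF NVW(2)] unitary_add_square[OF V W] X_def[symmetric] as_poly
        op_poly_mult[symmetric] op_poly_smult[symmetric] op_poly_add[symmetric] op_poly_diff[symmetric]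
      by (simp add: algebra_simps)
    then show ?thesis using XN DN by (simp add: trace_diff trace_scaleR N_intros)
  qed
  have trace_sum: "Re (\<tau> (op_poly [:0, 0, a - 4 * c, 0, c:] (abs_op (V - W))))
      + Re (\<tau> (op_poly [:0, 0, a - 4 * c, 0, c:] (abs_op (V + W)))) = 2 powr p - 2 * c * Re (\<tau> D)" for c
    unfolding trace_minus trace_plus using XN a
    by (simp add: trace_diff trace_add trace_scaleR N_intros trace_id algebra_simps)
  have poly_val: "poly [:0, 0, a - 4 * c, 0, c:] t = a * t\<^sup>2 - c * (t\<^sup>2 * (4 - t\<^sup>2))" for c t :: real
    by (simp add: power2_eq_square algebra_simps)
  have eq': "Lp_integral p (V - W) + Lp_integral p (V + W) = 2 powr p"
    using eq by (simp add: W_def)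
  have "Re (\<tau> D) \<le> 0"
  proof (cases "p < 2")
    case True
    obtain c where c: "c > 0" "\<And>t. t \<in> {0..2} \<Longrightarrow> a * t\<^sup>2 + c * (t\<^sup>2 * (4 - t\<^sup>2)) \<le> t powr p"
      using powr_chord_defect_lt_2[OF p(1) True] by (auto simp: a_def)
    have le: "poly [:0, 0, a - 4 * (- c), 0, - c:] t \<le> t powr p" if "t \<in> {0..2}" for t
      unfolding poly_val using c(2)[OF that] by simp
    have "Re (\<tau> (op_poly [:0, 0, a - 4 * (- c), 0, - c:] (abs_op (V - W)))) \<le> Lp_integral p (V - W)"
      "Re (\<tau> (op_poly [:0, 0, a - 4 * (- c), 0, - c:] (abs_op (V + W)))) \<le> Lp_integral p (V + W)"
      using norm_unitary_diff_le[OF V W] norm_unitary_add_le[OF V W]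
      by (intro Lp_integral_ge NVW p le; simp)+
    then have "2 powr p - 2 * (- c) * Re (\<tau> D) \<le> 2 powr p"
      using trace_sum[of "- c"] eq' by linarith
    then show ?thesis using c(1) by (simp add: mult_le_0_iff)
  next
    case False
    then have "2 < p" using p by simp
    then obtain c where c: "c > 0" "\<And>t. t \<in> {0..2} \<Longrightarrow> t powr p \<le> a * t\<^sup>2 - c * (t\<^sup>2 * (4 - t\<^sup>2))"
      using powr_chord_defect_gt_2[of p] by (auto simp: a_def)
    have le: "t powr p \<le> poly [:0, 0, a - 4 * c, 0, c:] t" if "t \<in> {0..2}" for t
      unfolding poly_val using c(2)[OF that] by simp
    have "Lp_integral p (V - W) \<le> Re (\<tau> (op_poly [:0, 0, a - 4 * c, 0, c:] (abs_op (V - W))))"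
      "Lp_integral p (V + W) \<le> Re (\<tau> (op_poly [:0, 0, a - 4 * c, 0, c:] (abs_op (V + W))))"
      using norm_unitary_diff_le[OF V W] norm_unitary_add_le[OF V W]
      by (intro Lp_integral_le NVW p le; simp)+
    then have "2 powr p \<le> 2 powr p - 2 * c * Re (\<tau> D)"
      using trace_sum[of c] eq' by linarith
    then show ?thesis using c(1) by (simp add: mult_le_0_iff)
  qed
  \<comment> \<open>Since \<open>X = Z + adjoint_op Z\<close> with \<open>Z\<close> unitary, the
    squares of \<open>Z\<close> and of its adjoint enter both sides with the same sign. Thus
    \<open>D\<close> measures the failure of \<open>Z\<close> to be self-adjoint.\<close>
  moreover have "D = adjoint_op (Z - adjoint_op Z) o\<^sub>L (Z - adjoint_op Z)"
  proof -
    have "4 *\<^sub>R id_blinfun = (2 *\<^sub>R id_blinfun + 2 *\<^sub>R id_blinfun :: 'h oper)"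
      by (simp flip: scaleR_left_distrib)
    then show ?thesis
      using ZD by (simp add: D_def X_Z adjoint_op_diff adjoint_op_bounded adjoint_op_adjoint_op
          compose_simps scaleR_2)
  qed
  ultimately have "Z - adjoint_op Z = 0"
    using ZD by (intro trace_adjoint_compose_zero) (auto intro: N_intros)
  then show ?thesis by (simp add: Z_def)
qed

section \<open>Distances between multiples of self-adjoint unitaries\<close>

lemma selfadjoint_unitary_square:
  assumes "U \<in> unitary_group N" "adjoint_op U = U"
  shows "U o\<^sub>L U = id_blinfun"
  using unitaryD(3)[OF assms(1)] assms(2) by simp

text \<open>The squared moduli are \<open>2 - 2 U\<close> and \<open>2 + 2 U\<close>, each with
  square 4 times itself because \<open>U\<close> squares to the identity. Their integrals are linear
  in \<tau>(U), which cancels in the sum.\<close>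

lemma antipodal_distances_symmetry:
  assumes U: "U \<in> unitary_group N" "adjoint_op U = U" and l: "cmod l = 1" and p: "0 < p"
  shows "Lp_integral p (op_scale l U - op_scale l id_blinfun)
    + Lp_integral p (op_scale l U + op_scale l id_blinfun) = 2 powr p"
proof -
  let ?V = "op_scale l U" and ?W = "op_scale l id_blinfun"
  have V: "?V \<in> unitary_group N" "?W \<in> unitary_group N"
    using U l unitary_id by (auto intro: unitary_op_scale)
  note UD = unitaryD[OF U(1)]
  have N: "?V - ?W \<in> N" "?V + ?W \<in> N" using UD by (auto intro: N_intros)
  have ll: "cnj l * l = 1" using l complex_norm_square[of l] by (simp add: mult.commute)
  have X: "cross_op ?V ?W = 2 *\<^sub>R U"
    using UD U(2) by (simp add: cross_op_scale bounded_ops_id adjoint_op_id ll op_scale_one scaleR_2)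
  have UU: "U o\<^sub>L U = id_blinfun" using U by (rule selfadjoint_unitary_square)
  have eight: "8 *\<^sub>R A = 4 *\<^sub>R A + 4 *\<^sub>R A" for A :: "'h oper"
    by (simp flip: scaleR_left_distrib)
  have "Lp_integral p (?V - ?W) = 2 powr (p - 2) * Re (\<tau> (2 *\<^sub>R id_blinfun - 2 *\<^sub>R U))"
  proof (rule Lp_integral_two_valued[OF N(1) p])
    show "2 *\<^sub>R id_blinfun - 2 *\<^sub>R U = adjoint_op (?V - ?W) o\<^sub>L (?V - ?W)"
      by (simp only: unitary_diff_square[OF V] X)
  qed (simp add: compose_simps UU scaleR_right_diff_distrib eight)
  moreover have "Lp_integral p (?V + ?W) = 2 powr (p - 2) * Re (\<tau> (2 *\<^sub>R id_blinfun + 2 *\<^sub>R U))"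
  proof (rule Lp_integral_two_valued[OF N(2) p])
    show "2 *\<^sub>R id_blinfun + 2 *\<^sub>R U = adjoint_op (?V + ?W) o\<^sub>L (?V + ?W)"
      by (simp only: unitary_add_square[OF V] X)
  qed (simp add: compose_simps UU scaleR_right_distrib eight)
  ultimately show ?thesis
    using UD by (simp add: trace_diff trace_add trace_scaleR N_intros trace_id powr_diff algebra_simps)
qed

lemma unimodular_products:
  assumes "c = Re (cnj a * b)"
  shows "cnj a * b + cnj b * a = complex_of_real (2 * c)"
  using assms by (simp add: complex_eq_iff)

text \<open>The squared moduli are the scalars \<open>2 - 2 * c\<close> and
  \<open>2 + 2 * c\<close>, with \<open>c\<close> the cosine of the angle between \<open>a\<close>
  and \<open>b\<close>; the distances therefore do not depend on \<open>U\<close>.\<close>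

lemma Lp_integral_multiples:
  assumes U: "U \<in> unitary_group N" and a: "cmod a = 1" and b: "cmod b = 1" and p: "0 < p"
    and c: "c = Re (cnj a * b)" "\<bar>c\<bar> \<le> 1"
  shows "Lp_integral p (op_scale a U - op_scale b U) = (2 - 2 * c) powr (p / 2)"
    and "Lp_integral p (op_scale a U + op_scale b U) = (2 + 2 * c) powr (p / 2)"
proof -
  let ?V = "op_scale a U" and ?W = "op_scale b U"
  have V: "?V \<in> unitary_group N" "?W \<in> unitary_group N"
    using U a b by (auto intro: unitary_op_scale)
  note UD = unitaryD[OF U]
  have N: "?V - ?W \<in> N" "?V + ?W \<in> N" using UD by (auto intro: N_intros)
  have X: "cross_op ?V ?W = (2 * c) *\<^sub>R id_blinfun"
    using UD unimodular_products[OF c(1)]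
    by (simp add: cross_op_scale scaleR_eq_op_scale flip: op_scale_add_left)
  show "Lp_integral p (?V - ?W) = (2 - 2 * c) powr (p / 2)"
    using c(2) by (intro Lp_integral_scalar N p)
      (auto simp: unitary_diff_square[OF V] X scaleR_left_diff_distrib)
  show "Lp_integral p (?V + ?W) = (2 + 2 * c) powr (p / 2)"
    using c(2) by (intro Lp_integral_scalar N p)
      (auto simp: unitary_add_square[OF V] X scaleR_left_distrib)
qed

text \<open>The two hypotheses on distances bound \<open>Re (\<tau> X)\<close> by
  \<open>2 * c\<close> from opposite sides. The condition \<open>\<bar>c\<bar> < 1\<close> makes
  both tangent points positive, and \<open>c \<noteq> 0\<close> allows division to reach
  \<open>Re s = 1\<close>, the equality case for two unitaries.\<close>

lemma symmetries_eq_if_distances: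
  assumes S: "S \<in> unitary_group N" "adjoint_op S = S" and U: "U \<in> unitary_group N" "adjoint_op U = U"
    and a: "cmod a = 1" and b: "cmod b = 1" and p: "0 < p"
    and c: "c = Re (cnj a * b)" "\<bar>c\<bar> < 1" "c \<noteq> 0"
    and minus: "Lp_integral p (op_scale a S - op_scale b U) = (2 - 2 * c) powr (p / 2)"
    and plus: "Lp_integral p (op_scale a S + op_scale b U) = (2 + 2 * c) powr (p / 2)"
  shows "S = U"
proof -
  let ?V = "op_scale a S" and ?W = "op_scale b U"
  have V: "?V \<in> unitary_group N" "?W \<in> unitary_group N"
    using S U a b by (auto intro: unitary_op_scale)
  note UD = unitaryD[OF U(1)] and SD = unitaryD[OF S(1)]
  have N: "?V - ?W \<in> N" "?V + ?W \<in> N" using UD SD by (auto intro: N_intros)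
  define X where "X = cross_op ?V ?W"
  have XN: "X \<in> N" unfolding X_def using UD SD by (intro N_cross_op N_intros)
  define s where "s = \<tau> (S o\<^sub>L U)"
  \<comment> \<open>Traciality lets both halves of \<open>X\<close> share the factor
    \<open>s\<close>, whose coefficient is then real.\<close>
  have s': "\<tau> (U o\<^sub>L S) = s" unfolding s_def using UD SD by (intro trace_commute)
  have "\<tau> X = (cnj a * b + cnj b * a) * s"
    using UD SD S(2) U(2)
    by (simp add: X_def cross_op_scale trace_add trace_op_scale N_intros s' s_def distrib_right)
  then have tX: "Re (\<tau> X) = 2 * c * Re s" by (simp add: unimodular_products[OF c(1)])
  have tm: "Re (\<tau> (adjoint_op (?V - ?W) o\<^sub>L (?V - ?W))) = 2 - Re (\<tau> X)"
    unfolding unitary_diff_square[OF V] X_def[symmetric]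
    using XN by (simp add: trace_diff trace_scaleR N_intros trace_id)
  have tp: "Re (\<tau> (adjoint_op (?V + ?W) o\<^sub>L (?V + ?W))) = 2 + Re (\<tau> X)"
    unfolding unitary_add_square[OF V] X_def[symmetric]
    using XN by (simp add: trace_add trace_scaleR N_intros trace_id)
  have pos: "0 < 2 - 2 * c" "0 < 2 + 2 * c" using c(2) by auto
  have "Re (\<tau> X) = 2 * c"
  proof (cases "2 \<le> p")
    case True
    then show ?thesis
      using trace_square_bound(1)[OF N(1) p pos(1) minus] trace_square_bound(1)[OF N(2) p pos(2) plus]
      unfolding tm tp by linarith
  next
    case False
    then show ?thesis
      using trace_square_bound(2)[OF N(1) p pos(1) minus] trace_square_bound(2)[OF N(2) p pos(2) plus]
      unfolding tm tp by linarith
  qed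
  then have "Re s = 1" using tX c(3) by simp
  moreover have "\<tau> (adjoint_op (S - U) o\<^sub>L (S - U)) = 2 - 2 * s"
    unfolding unitary_diff_square[OF S(1) U(1)] cross_op_def S(2) U(2)
    using UD SD by (simp add: trace_diff trace_add trace_scaleR N_intros trace_id s' s_def[symmetric])
  ultimately have "S - U = 0"
    using UD SD by (intro trace_adjoint_compose_zero) (auto intro: N_intros)
  then show ?thesis by simp
qed

end

section \<open>Fixed multiples of self-adjoint unitaries\<close>

theorem lemma2p7:
  fixes N :: "('h::complex_hilbert \<Rightarrow>\<^sub>L 'h) set"
    and \<tau> :: "('h \<Rightarrow>\<^sub>L 'h) \<Rightarrow> complex"
    and p :: real
    and \<psi> :: "('h \<Rightarrow>\<^sub>L 'h) \<Rightarrow> ('h \<Rightarrow>\<^sub>L 'h)"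
  assumes "0 < p" and "p \<noteq> 2"
    and "II1_factor N" and "is_trace N \<tau>"
    and "Lp_isometry N \<tau> p \<psi>"
    and "\<psi> ` unitary_group N = unitary_group N"
    and "\<And>U. U \<in> unitary_group N \<Longrightarrow> adjoint_op U = U \<Longrightarrow> \<psi> U = U"
    and "\<And>\<theta> :: real. \<psi> (op_scale (exp (\<i> * \<theta>)) id_blinfun) = op_scale (exp (\<i> * \<theta>)) id_blinfun"
  shows "\<forall>U\<in>unitary_group N. adjoint_op U = U \<longrightarrow>
           (\<forall>\<theta> :: real. \<psi> (op_scale (exp (\<i> * \<theta>)) U) = op_scale (exp (\<i> * \<theta>)) U)"
proof (intro ballI impI)
  interpret tracial_algebra N \<tau>
    using assms(3,4) by unfold_locales (auto simp: II1_factor_def factor_def is_trace_def)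
  fix U assume U: "U \<in> unitary_group N" "adjoint_op U = U"
  have UN: "U \<in> bounded_ops" using unitaryD[OF U(1)] by simp
  have \<psi>_unitary: "\<psi> A \<in> unitary_group N" if "A \<in> unitary_group N" for A
    using assms(5) that by (auto simp: Lp_isometry_def)
  have iso: "Lp_integral p (\<psi> A - \<psi> B) = Lp_integral p (A - B)"
    if "A \<in> unitary_group N" "B \<in> unitary_group N" for A B
  proof -
    have "Lp_norm \<tau> p (\<psi> A - \<psi> B) = Lp_norm \<tau> p (A - B)"
      using assms(5) that by (simp add: Lp_isometry_def)
    then show ?thesis
      using that \<psi>_unitary assms(1) unitaryD(1) N_diff by (subst (asm) Lp_norm_eq_iff) auto
  qed
  have scalars: "\<psi> (op_scale (cis \<theta>) id_blinfun) = op_scale (cis \<theta>) id_blinfun" for \<theta>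
    using assms(8)[of \<theta>] by (simp add: cis_conv_exp)
  have cis_pi: "cis (\<theta> + pi) = - cis \<theta>" for \<theta> by (simp add: cis_mult[symmetric])
  \<comment> \<open>A sum \<open>A + B\<close> is handled as the distance from \<open>A\<close> to
    \<open>- B\<close>, so the isometry must also be known at negative multiples.\<close>
  have neg_scalars: "\<psi> (op_scale (- cis \<theta>) id_blinfun) = op_scale (- cis \<theta>) id_blinfun" for \<theta>
    using scalars[of "\<theta> + pi"] unfolding cis_pi .
  have scaled: "op_scale (cis \<theta>) A \<in> unitary_group N" if "A \<in> unitary_group N" for \<theta> A
    using that by (intro unitary_op_scale) auto
  have neg_scaled: "op_scale (- cis \<theta>) A \<in> unitary_group N" if "A \<in> unitary_group N" for \<theta> A
    using that by (intro unitary_op_scale) auto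
  have symmetry: "\<exists>S\<in>unitary_group N. adjoint_op S = S \<and>
      \<psi> (op_scale (cis \<theta>) U) = op_scale (cis \<theta>) S" for \<theta>
  proof -
    let ?l = "cis \<theta>"
    define V where "V = \<psi> (op_scale ?l U)"
    have V: "V \<in> unitary_group N" unfolding V_def by (intro \<psi>_unitary scaled U)
    define S where "S = op_scale (cnj ?l) V"
    have "Lp_integral p (V - op_scale ?l id_blinfun)
        = Lp_integral p (op_scale ?l U - op_scale ?l id_blinfun)"
      using iso[OF scaled[OF U(1), of \<theta>] scaled[OF unitary_id, of \<theta>]] by (simp add: V_def scalars)
    moreover have "Lp_integral p (V + op_scale ?l id_blinfun)
        = Lp_integral p (op_scale ?l U + op_scale ?l id_blinfun)"
      using iso[OF scaled[OF U(1), of \<theta>] neg_scaled[OF unitary_id, of \<theta>]]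
      by (simp only: neg_scalars V_def) (simp add: op_scale_minus_left)
    ultimately have "adjoint_op S = S"
      unfolding S_def using antipodal_distances_symmetry[OF U, of ?l p] assms(1,2)
      by (intro antipodal_distances_imp_selfadjoint[OF V, of _ p]) auto
    moreover have "S \<in> unitary_group N" unfolding S_def using V by (intro unitary_op_scale) auto
    moreover have "V = op_scale ?l S"
      by (simp add: S_def op_scale_op_scale op_scale_one cis_cnj cis_mult)
    ultimately show ?thesis unfolding V_def by blast
  qed
  \<comment> \<open>Propagation of fixedness from the antipodal pair at angle \<open>\<phi>\<close>
    to the angle \<open>\<theta>\<close>; the cosine conditions exclude perpendicular and parallel
    directions.\<close>
  have transfer: "\<psi> (op_scale (cis \<theta>) U) = op_scale (cis \<theta>) U"
    if fixed: "\<psi> (op_scale (cis \<phi>) U) = op_scale (cis \<phi>) U"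
        "\<psi> (op_scale (- cis \<phi>) U) = op_scale (- cis \<phi>) U"
      and c: "cos (\<phi> - \<theta>) \<noteq> 0" "\<bar>cos (\<phi> - \<theta>)\<bar> < 1" for \<theta> \<phi>
  proof -
    obtain S where S: "S \<in> unitary_group N" "adjoint_op S = S"
      "\<psi> (op_scale (cis \<theta>) U) = op_scale (cis \<theta>) S"
      using symmetry by blast
    have c_Re: "cos (\<phi> - \<theta>) = Re (cnj (cis \<theta>) * cis \<phi>)"
      by (simp add: cis_cnj cis_mult)
    have "Lp_integral p (op_scale (cis \<theta>) S - op_scale (cis \<phi>) U)
        = Lp_integral p (op_scale (cis \<theta>) U - op_scale (cis \<phi>) U)"
      using iso[OF scaled[OF U(1), of \<theta>] scaled[OF U(1), of \<phi>]] by (simp add: S(3) fixed)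
    moreover have "Lp_integral p (op_scale (cis \<theta>) S + op_scale (cis \<phi>) U)
        = Lp_integral p (op_scale (cis \<theta>) U + op_scale (cis \<phi>) U)"
      using iso[OF scaled[OF U(1), of \<theta>] neg_scaled[OF U(1), of \<phi>]]
      by (simp only: S(3) fixed) (simp add: op_scale_minus_left)
    ultimately have "S = U"
      using c(2) by (intro symmetries_eq_if_distances[OF S(1,2) U _ _ assms(1) c_Re c(2,1)])
        (auto simp: Lp_integral_multiples[OF U(1) _ _ assms(1) c_Re])
    then show ?thesis using S(3) by simp
  qed
  \<comment> \<open>The starting pair for \<open>transfer\<close>: both \<open>U\<close> and
    \<open>- U\<close> are self-adjoint unitaries.\<close>
  have real_multiples: "\<psi> (op_scale c U) = op_scale c U" if "c = 1 \<or> c = - 1" for c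
  proof (rule assms(7))
    show "op_scale c U \<in> unitary_group N" using that U by (intro unitary_op_scale) auto
    show "adjoint_op (op_scale c U) = op_scale c U"
      using that U(2) by (auto simp: adjoint_op_scale[OF UN])
  qed
  have generic: "\<psi> (op_scale (cis \<theta>) U) = op_scale (cis \<theta>) U" if "cos \<theta> \<noteq> 0" for \<theta>
  proof (cases "sin \<theta> = 0")
    case True
    then have "cos \<theta> = 1 \<or> cos \<theta> = - 1" using sin_zero_abs_cos_one by fastforce
    then have "cis \<theta> = 1 \<or> cis \<theta> = - 1" using True by (auto simp: complex_eq_iff)
    then show ?thesis by (rule real_multiples)
  next
    case False
    have "(cos \<theta>)\<^sup>2 < 1" using False sin_cos_squared_add[of \<theta>] by (smt (verit) zero_less_power2)
    then have "\<bar>cos \<theta>\<bar> < 1" by (simp add: abs_square_less_1)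
    then show ?thesis
      using that transfer[of 0 \<theta>] real_multiples[of 1] real_multiples[of "- 1"] by simp
  qed
  have "\<psi> (op_scale (cis \<theta>) U) = op_scale (cis \<theta>) U" for \<theta>
  proof (cases "cos \<theta> = 0")
    case True
    \<comment> \<open>Seen from \<open>pi / 4\<close>, the angles with vanishing cosine are at an
      odd multiple of 45 degrees, so the relevant cosine has modulus
      \<open>sqrt 2 / 2\<close>.\<close>
    have half: "0 < sqrt 2 / 2" "sqrt 2 / 2 < 1" using sqrt2_less_2 by auto
    have "\<bar>sin \<theta>\<bar> = 1" using True sin_cos_squared_add[of \<theta>] by (auto simp: power2_eq_1_iff)
    then have "\<bar>cos (pi / 4 - \<theta>)\<bar> = sqrt 2 / 2"
      using True by (simp add: cos_diff cos_45 sin_45 abs_mult)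
    then have "cos (pi / 4 - \<theta>) \<noteq> 0" "\<bar>cos (pi / 4 - \<theta>)\<bar> < 1" using half by auto
    moreover have "\<psi> (op_scale (cis (pi / 4)) U) = op_scale (cis (pi / 4)) U"
      by (rule generic) (simp add: cos_45)
    moreover have "\<psi> (op_scale (- cis (pi / 4)) U) = op_scale (- cis (pi / 4)) U"
      using generic[of "pi / 4 + pi"] unfolding cis_pi cos_periodic_pi by (simp add: cos_45)
    ultimately show ?thesis using transfer[of "pi / 4" \<theta>] by blast
  qed (rule generic)
  then show "\<forall>\<theta> :: real. \<psi> (op_scale (exp (\<i> * \<theta>)) U) = op_scale (exp (\<i> * \<theta>)) U"
    by (simp add: cis_conv_exp)
qed

end
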